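(* Let $N\in\{2,3,\ldots\}$ and let $\varphi\in L^2(\mathbb{R})$ be a scaling function (for scale $N$) with support in $[0,Ng-1]$, where $g\in\{1,2,3,\ldots\}$. Then there exist wavelet functions $\psi_1,\ldots,\psi_{N-1}\in L^2(\mathbb{R})$ associated with $\varphi$ by multiresolution wavelet analysis which also have support in $[0,Ng-1]$.
   Context: Define unitary operators on $L^2(\mathbb{R})$ by $(U\xi)(x)=N^{-1/2}\xi(N^{-1}x)$ and $(T\xi)(x)=\xi(x-1)$. A scaling function (for scale $N$) is a function $\varphi\in L^2(\mathbb{R})$ such that, with $\mathcal{V}_0$ the closed linear span of all $T^k\varphi$, $k\in\mathbb{Z}$: (1) $\{T^k\varphi: k\in\mathbb{Z}\}$ is an orthonormal set in $L^2(\mathbb{R})$; (2) $U\varphi\in\mathcal{V}_0$; (3) $\bigcap_{n\in\mathbb{Z}}U^n\mathcal{V}_0=\{0\}$; (4) the closed linear span of $\bigcup_{n\in\mathbb{Z}}U^n\mathcal{V}_0$ is $L^2(\mathbb{R})$. Let $\hat\xi$ denote the Fourier transform, $\hat\xi(t)=(2\pi)^{-1/2}\int_{\mathbb{R}}e^{-itx}\xi(x)\,dx$ (extended to $L^2$). The low-pass filter of $\varphi$ is the $2\pi$-periodic function $m_0$ (in $L^2$ of a period) determined by $\sqrt{N}\,\hat\varphi(Nt)=m_0(t)\hat\varphi(t)$; explicitly, if $U\varphi=\sum_n b_n\varphi(\cdot-n)$ then $m_0(t)=\sum_n b_n e^{-int}$. Wavelet functions associated with $\varphi$ by multiresolution wavelet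 analysis are functions $\psi_1,\ldots,\psi_{N-1}$ given by $\sqrt{N}\,\hat\psi_i(Nt)=m_i(t)\hat\varphi(t)$, where $m_1,\ldots,m_{N-1}$ are $2\pi$-periodic functions (square integrable over a period) such that together with $m_0$ $$\sum_{k=0}^{N-1}\overline{m_i(t+2\pi k/N)}\,m_j(t+2\pi k/N)=\delta_{i,j}N\qquad(0\le i,j\le N-1)$$ for almost all $t\in\mathbb{R}$. (For such functions $\{T^k\psi_i: k\in\mathbb{Z},\,1\le i\le N-1\}$ is an orthonormal basis of $U^{-1}\mathcal{V}_0\cap\mathcal{V}_0^{\perp}$, and $\{U^nT^k\psi_i: n,k\in\mathbb{Z},\,1\le i\le N-1\}$ is an orthonormal basis of $L^2(\mathbb{R})$.) *)

theory Defs
  imports "HOL-Analysis.Analysis"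
begin

text \<open>Elements of \<open>L\<^sup>2(\<real>)\<close> are represented by Borel measurable functions (every class has such a
  representative). Equality and supports of \<open>L\<^sup>2\<close> functions are therefore read modulo null sets.\<close>

definition L2 :: "(real \<Rightarrow> complex) set" where
  "L2 = {f \<in> borel_measurable lborel. integrable lborel (\<lambda>x. (cmod (f x))\<^sup>2)}"

definition L2_inner :: "(real \<Rightarrow> complex) \<Rightarrow> (real \<Rightarrow> complex) \<Rightarrow> complex" where
  "L2_inner f g = (LINT x|lborel. cnj (f x) * g x)"

definition L2_norm :: "(real \<Rightarrow> complex) \<Rightarrow> real" where
  "L2_norm f = sqrt (LINT x|lborel. (cmod (f x))\<^sup>2)"

definition L2_tendsto :: "(nat \<Rightarrow> real \<Rightarrow> complex) \<Rightarrow> (real \<Rightarrow> complex) \<Rightarrow> bool" where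
  "L2_tendsto X f \<longleftrightarrow> (\<forall>n. X n \<in> L2) \<and> f \<in> L2 \<and> (\<lambda>n. L2_norm (\<lambda>x. X n x - f x)) \<longlonglongrightarrow> 0"

definition supported_in :: "(real \<Rightarrow> complex) \<Rightarrow> real set \<Rightarrow> bool" where
  "supported_in f S \<longleftrightarrow> (AE x in lborel. x \<notin> S \<longrightarrow> f x = 0)"

definition lin_span :: "(real \<Rightarrow> complex) set \<Rightarrow> (real \<Rightarrow> complex) set" where
  "lin_span S = {\<lambda>x. \<Sum>f\<in>F. c f * f x | F c. finite F \<and> F \<subseteq> S}"

definition closed_span :: "(real \<Rightarrow> complex) set \<Rightarrow> (real \<Rightarrow> complex) set" where
  "closed_span S = {f. \<exists>X. (\<forall>n. X n \<in> lin_span S) \<and> L2_tendsto X f}"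


definition U_op :: "nat \<Rightarrow> (real \<Rightarrow> complex) \<Rightarrow> (real \<Rightarrow> complex)" where
  "U_op N \<xi> = (\<lambda>x. complex_of_real (real N powr (-1/2)) * \<xi> (x / real N))"

definition T_op :: "(real \<Rightarrow> complex) \<Rightarrow> (real \<Rightarrow> complex)" where
  "T_op \<xi> = (\<lambda>x. \<xi> (x - 1))"

text \<open>Integer powers of a bijective map; \<open>T_op\<close>, and \<open>U_op N\<close> for \<open>N > 0\<close>, are bijections on the
  space of all functions, with the powers given by the two lemmas below.\<close>

definition int_funpow :: "('a \<Rightarrow> 'a) \<Rightarrow> int \<Rightarrow> 'a \<Rightarrow> 'a" where
  "int_funpow F k = (if 0 \<le> k then F ^^ nat k else inv F ^^ nat (- k))"

lemma int_funpow_T_op: "int_funpow T_op k \<xi> = (\<lambda>x. \<xi> (x - of_int k))"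
proof -
  have inv: "inv T_op = (\<lambda>\<xi> x. \<xi> (x + 1))"
    by (rule inv_unique_comp) (auto simp: T_op_def fun_eq_iff)
  have pos: "(T_op ^^ n) \<xi> = (\<lambda>x. \<xi> (x - real n))" for n
    by (induction n) (auto simp: T_op_def fun_eq_iff algebra_simps)
  have neg: "(inv T_op ^^ n) \<xi> = (\<lambda>x. \<xi> (x + real n))" for n
    by (induction n) (auto simp: inv fun_eq_iff algebra_simps)
  show ?thesis
    by (auto simp: int_funpow_def pos neg)
qed

lemma int_funpow_U_op:
  assumes "N > 0"
  shows "int_funpow (U_op N) n \<xi> =
    (\<lambda>x. complex_of_real (real N powr (- of_int n / 2)) * \<xi> (real N powi (- n) * x))"
proof -
  let ?V = "\<lambda>(\<xi> :: real \<Rightarrow> complex) x. complex_of_real (real N powr (1/2)) * \<xi> (x * real N)"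
  have c: "real N powr (-1/2) * real N powr (1/2) = 1"
    using assms by (simp flip: powr_add)
  have c': "complex_of_real (real N powr (-1/2)) * complex_of_real (real N powr (1/2)) = 1"
    by (metis c of_real_1 of_real_mult)
  have inv: "inv (U_op N) = ?V"
  proof (rule inv_unique_comp)
    show "U_op N \<circ> ?V = id"
    proof (intro ext)
      fix \<xi> x
      have "(U_op N \<circ> ?V) \<xi> x = (complex_of_real (real N powr (-1/2)) *
          complex_of_real (real N powr (1/2))) * \<xi> x"
        using assms by (simp add: U_op_def)
      then show "(U_op N \<circ> ?V) \<xi> x = id \<xi> x"
        unfolding c' by simp
    qed
    show "?V \<circ> U_op N = id"
    proof (intro ext)
      fix \<xi> x
      have "(?V \<circ> U_op N) \<xi> x = (complex_of_real (real N powr (-1/2)) *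
          complex_of_real (real N powr (1/2))) * \<xi> x"
        using assms by (simp add: U_op_def)
      then show "(?V \<circ> U_op N) \<xi> x = id \<xi> x"
        unfolding c' by simp
    qed
  qed
  have pos: "(U_op N ^^ m) \<xi> = (\<lambda>x. complex_of_real (real N powr (- real m / 2)) * \<xi> (x / real N ^ m))" for m
  proof (induction m)
    case (Suc m)
    have "real N powr (- real (Suc m) / 2) = real N powr (-1/2) * real N powr (- real m / 2)"
      by (simp flip: powr_add add: field_simps)
    then show ?case
      unfolding funpow.simps o_apply Suc.IH
      by (simp only: U_op_def of_real_mult power_Suc divide_divide_eq_left mult.assoc)
  qed (use assms in simp)
  have neg: "(inv (U_op N) ^^ m) \<xi> = (\<lambda>x. complex_of_real (real N powr (real m / 2)) * \<xi> (x * real N ^ m))" for m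
  proof (induction m)
    case (Suc m)
    have "real N powr (real (Suc m) / 2) = real N powr (1/2) * real N powr (real m / 2)"
      by (simp flip: powr_add add: field_simps)
    then show ?case
      unfolding funpow.simps o_apply Suc.IH
      by (simp only: inv of_real_mult power_Suc mult.assoc)
  qed (use assms in simp)
  show ?thesis
    by (auto simp: int_funpow_def pos neg power_int_def field_simps)
qed


definition V0 :: "(real \<Rightarrow> complex) \<Rightarrow> (real \<Rightarrow> complex) set" where
  "V0 \<phi> = closed_span (range (\<lambda>k. int_funpow T_op k \<phi>))"

definition scaling_function :: "nat \<Rightarrow> (real \<Rightarrow> complex) \<Rightarrow> bool" where
  "scaling_function N \<phi> \<longleftrightarrow>
     \<phi> \<in> L2 \<and>
     (\<forall>k l. L2_inner (int_funpow T_op k \<phi>) (int_funpow T_op l \<phi>) = (if k = l then 1 else 0)) \<and>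
     U_op N \<phi> \<in> V0 \<phi> \<and>
     (\<Inter>n. int_funpow (U_op N) n ` V0 \<phi>) = {f \<in> L2. AE x in lborel. f x = 0} \<and>
     closed_span (\<Union>n. int_funpow (U_op N) n ` V0 \<phi>) = L2"


definition fourier_L1 :: "(real \<Rightarrow> complex) \<Rightarrow> (real \<Rightarrow> complex)" where
  "fourier_L1 \<xi> = (\<lambda>t. complex_of_real ((2 * pi) powr (-1/2)) *
     (LINT x|lborel. exp (- \<i> * complex_of_real (t * x)) * \<xi> x))"

text \<open>The graph of the continuous extension of the Fourier transform from \<open>L\<^sup>1 \<inter> L\<^sup>2\<close> to \<open>L\<^sup>2\<close>, i.e.
  the closure of the graph of \<open>fourier_L1\<close> there. By Plancherel's theorem every \<open>\<xi> \<in> L2\<close> has a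
  transform \<open>\<eta>\<close>, determined up to a null set.\<close>

definition is_fourier :: "(real \<Rightarrow> complex) \<Rightarrow> (real \<Rightarrow> complex) \<Rightarrow> bool" where
  "is_fourier \<xi> \<eta> \<longleftrightarrow>
     (\<exists>X. (\<forall>n. integrable lborel (X n)) \<and> L2_tendsto X \<xi> \<and> L2_tendsto (\<lambda>n. fourier_L1 (X n)) \<eta>)"

definition periodic_L2 :: "(real \<Rightarrow> complex) \<Rightarrow> bool" where
  "periodic_L2 m \<longleftrightarrow>
     m \<in> borel_measurable lborel \<and> (\<forall>t. m (t + 2 * pi) = m t) \<and>
     set_integrable lborel {0..2 * pi} (\<lambda>t. (cmod (m t))\<^sup>2)"

definition filter_relation ::
    "nat \<Rightarrow> (real \<Rightarrow> complex) \<Rightarrow> (real \<Rightarrow> complex) \<Rightarrow> (real \<Rightarrow> complex) \<Rightarrow> bool" where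
  "filter_relation N \<phi> m \<psi> \<longleftrightarrow>
     (\<exists>\<phi>h \<psi>h. is_fourier \<phi> \<phi>h \<and> is_fourier \<psi> \<psi>h \<and>
        (AE t in lborel. complex_of_real (sqrt (real N)) * \<psi>h (real N * t) = m t * \<phi>h t))"

definition low_pass_filter :: "nat \<Rightarrow> (real \<Rightarrow> complex) \<Rightarrow> (real \<Rightarrow> complex) \<Rightarrow> bool" where
  "low_pass_filter N \<phi> m0 \<longleftrightarrow> periodic_L2 m0 \<and> filter_relation N \<phi> m0 \<phi>"

text \<open>Only the values \<open>\<psi> 1, \<dots>, \<psi> (N - 1)\<close> of the family \<open>\<psi>\<close> are relevant.\<close>

definition wavelet_functions ::
    "nat \<Rightarrow> (real \<Rightarrow> complex) \<Rightarrow> (nat \<Rightarrow> real \<Rightarrow> complex) \<Rightarrow> bool" where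
  "wavelet_functions N \<phi> \<psi> \<longleftrightarrow>
     (\<exists>m. low_pass_filter N \<phi> (m 0) \<and>
        (\<forall>i\<in>{1..N - 1}. \<psi> i \<in> L2 \<and> periodic_L2 (m i) \<and> filter_relation N \<phi> (m i) (\<psi> i)) \<and>
        (AE t in lborel. \<forall>i<N. \<forall>j<N.
           (\<Sum>k<N. cnj (m i (t + 2 * pi * real k / real N)) * m j (t + 2 * pi * real k / real N))
             = (if i = j then of_nat N else 0)))"

end

theory Submission
  imports Defs
begin

text \<open>
  Since \<open>\<phi>\<close> has compact support, \<open>U \<phi> = \<Sum>n. b n * \<phi> (\<cdot> - n)\<close> is a finite sum, and comparing the ends of
  the supports of both sides gives \<open>b n = 0\<close> unless \<open>0 \<le> n \<le> D\<close>, where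
  \<open>D = (N - 1) (N g - 1) = N d + 1\<close> and \<open>d = (N - 1) g - 1\<close>. The polyphase vectors
  \<open>v l = (b (l N + r))\<^sub>r\<close>, \<open>l \<le> d\<close>, form a polynomial \<open>v(z) = \<Sum>l. v l z\<^sup>l\<close> that has norm one on the unit
  circle. If \<open>Q\<close> is the orthogonal projection onto the line of the top coefficient \<open>v d\<close>, then
  \<open>Q (v 0) = 0\<close>, so \<open>(1 - Q + z\<^bsup>-1\<^esup> Q) v(z)\<close> is a polynomial of degree \<open>d - 1\<close>, and induction completes \<open>v(z)\<close> to
  a polynomial matrix of degree \<open>d\<close>, unitary on the circle. By this choice of \<open>Q\<close> the top
  coefficient of every column is a multiple of \<open>v d\<close>, which lives in the components \<open>r = 0, 1\<close> if \<open>d > 0\<close>; so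
  all the filters \<open>m i\<close> have degree at most \<open>D\<close>, which is exactly the bound that puts the support of \<open>\<psi> i\<close>
  into \<open>[0, N g - 1]\<close>.

  The Fourier transform of a compactly supported \<open>L\<^sup>2\<close> function is seen to be in \<open>L\<^sup>2\<close> by
  integrating Bessel's inequality for shifted exponential systems.
\<close>

section \<open>Square integrable functions\<close>

lemma borel_measurable_cnj [measurable (raw)]:
  "f \<in> borel_measurable M \<Longrightarrow> (\<lambda>x. cnj (f x)) \<in> borel_measurable M"
  by (rule borel_measurable_continuous_on[where f = cnj]) (intro continuous_intros)

lemma L2_measurable [measurable_dest]: "f \<in> L2 \<Longrightarrow> f \<in> borel_measurable borel"
  by (simp add: L2_def)

section \<open>Vector space structure and inner product of \<open>L2\<close>\<close>

lemma L2_integrable_mult: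
  assumes f: "f \<in> L2" and g: "g \<in> L2"
  shows "integrable lborel (\<lambda>x. cnj (f x) * g x)"
proof (rule Bochner_Integration.integrable_bound)
  show "integrable lborel (\<lambda>x. (cmod (f x))\<^sup>2 + (cmod (g x))\<^sup>2)"
    using f g by (simp add: L2_def)
  have [measurable]: "f \<in> borel_measurable borel" "g \<in> borel_measurable borel"
    using f g by (auto dest: L2_measurable)
  show "(\<lambda>x. cnj (f x) * g x) \<in> borel_measurable lborel"
    unfolding measurable_lborel1 by measurable
  have "a * b \<le> a\<^sup>2 + b\<^sup>2" if "a \<ge> 0" "b \<ge> 0" for a b :: real
    using sum_squares_bound[of a b] mult_nonneg_nonneg[OF that] by linarith
  then show "AE x in lborel. norm (cnj (f x) * g x) \<le> norm ((cmod (f x))\<^sup>2 + (cmod (g x))\<^sup>2)"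
    by (simp add: norm_mult)
qed

lemma L2_add [intro]:
  assumes f: "f \<in> L2" and g: "g \<in> L2"
  shows "(\<lambda>x. f x + g x) \<in> L2"
proof -
  have [measurable]: "f \<in> borel_measurable borel" "g \<in> borel_measurable borel"
    using f g by (auto dest: L2_measurable)
  have "integrable lborel (\<lambda>x. (cmod (f x + g x))\<^sup>2)"
  proof (rule Bochner_Integration.integrable_bound)
    show "integrable lborel (\<lambda>x. 2 * (cmod (f x))\<^sup>2 + 2 * (cmod (g x))\<^sup>2)"
      using f g by (simp add: L2_def)
    have "(cmod (a + b))\<^sup>2 \<le> 2 * (cmod a)\<^sup>2 + 2 * (cmod b)\<^sup>2" for a b
    proof -
      have "(cmod (a + b))\<^sup>2 \<le> (cmod a + cmod b)\<^sup>2"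
        by (simp add: norm_triangle_ineq power_mono)
      also have "\<dots> \<le> 2 * (cmod a)\<^sup>2 + 2 * (cmod b)\<^sup>2"
        using sum_squares_bound[of "cmod a" "cmod b"] by (simp add: power2_sum)
      finally show ?thesis .
    qed
    then show "AE x in lborel. norm ((cmod (f x + g x))\<^sup>2)
        \<le> norm (2 * (cmod (f x))\<^sup>2 + 2 * (cmod (g x))\<^sup>2)"
      by simp
  qed measurable
  then show ?thesis
    by (simp add: L2_def)
qed

lemma L2_mult_left [intro]: "f \<in> L2 \<Longrightarrow> (\<lambda>x. c * f x) \<in> L2"
  by (auto simp: L2_def norm_mult power_mult_distrib)

lemma L2_sum [intro]: "(\<And>i. i \<in> I \<Longrightarrow> f i \<in> L2) \<Longrightarrow> (\<lambda>x. \<Sum>i\<in>I. f i x) \<in> L2"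
proof (induction I rule: infinite_finite_induct)
  case (insert i I)
  then have "(\<lambda>x. f i x + (\<Sum>j\<in>I. f j x)) \<in> L2"
    by (intro L2_add) auto
  then show ?case
    using insert by simp
qed (auto simp: L2_def)

lemma L2_lin_comb [intro]: "(\<And>i. i \<in> I \<Longrightarrow> f i \<in> L2) \<Longrightarrow> (\<lambda>x. \<Sum>i\<in>I. c i * f i x) \<in> L2"
  by (intro L2_sum L2_mult_left)

lemma L2_diff [intro]: "f \<in> L2 \<Longrightarrow> g \<in> L2 \<Longrightarrow> (\<lambda>x. f x - g x) \<in> L2"
  using L2_add[of f "\<lambda>x. -1 * g x"] L2_mult_left[of g "-1"] by simp

lemma L2_affine:
  assumes "f \<in> L2" and "c \<noteq> 0"
  shows "(\<lambda>x. f (t + c * x)) \<in> L2"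
proof -
  have [measurable]: "f \<in> borel_measurable borel"
    using assms by (simp add: L2_def)
  show ?thesis
    using assms lborel_integrable_real_affine[of "\<lambda>x. (cmod (f x))\<^sup>2" c t]
    by (simp add: L2_def)
qed

lemma L2_inner_lin_comb_right:
  assumes "f \<in> L2" and "\<And>i. i \<in> I \<Longrightarrow> g i \<in> L2"
  shows "L2_inner f (\<lambda>x. \<Sum>i\<in>I. c i * g i x) = (\<Sum>i\<in>I. c i * L2_inner f (g i))"
proof -
  have "L2_inner f (\<lambda>x. \<Sum>i\<in>I. c i * g i x) = (LINT x|lborel. (\<Sum>i\<in>I. c i * (cnj (f x) * g i x)))"
    by (simp add: L2_inner_def sum_distrib_left mult_ac)
  also have "\<dots> = (\<Sum>i\<in>I. LINT x|lborel. c i * (cnj (f x) * g i x))"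
    by (intro Bochner_Integration.integral_sum integrable_mult_right L2_integrable_mult assms)
  also have "\<dots> = (\<Sum>i\<in>I. c i * L2_inner f (g i))"
    by (simp add: L2_inner_def)
  finally show ?thesis .
qed

lemma L2_inner_commute: "L2_inner g f = cnj (L2_inner f g)"
proof -
  have "cnj (L2_inner f g) = (LINT x|lborel. cnj (cnj (f x) * g x))"
    unfolding L2_inner_def by (rule Bochner_Integration.integral_cnj[symmetric])
  then show ?thesis
    by (simp add: L2_inner_def mult.commute)
qed

lemma L2_inner_lin_comb_left:
  assumes "f \<in> L2" and "\<And>i. i \<in> I \<Longrightarrow> g i \<in> L2"
  shows "L2_inner (\<lambda>x. \<Sum>i\<in>I. c i * g i x) f = (\<Sum>i\<in>I. cnj (c i) * L2_inner (g i) f)"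
  by (simp add: L2_inner_lin_comb_right[OF assms] L2_inner_commute[of _ f])

lemma L2_inner_diff_right:
  assumes "f \<in> L2" "g \<in> L2" "h \<in> L2"
  shows "L2_inner f (\<lambda>x. g x - h x) = L2_inner f g - L2_inner f h"
  using assms by (simp add: L2_inner_def L2_integrable_mult right_diff_distrib)

lemma L2_inner_add_right:
  assumes "f \<in> L2" "g \<in> L2" "h \<in> L2"
  shows "L2_inner f (\<lambda>x. g x + h x) = L2_inner f g + L2_inner f h"
  using assms by (simp add: L2_inner_def L2_integrable_mult distrib_left)

lemma L2_inner_self: "L2_inner f f = of_real (LINT x|lborel. (cmod (f x))\<^sup>2)"
  by (simp add: L2_inner_def complex_norm_square[symmetric] mult.commute flip: integral_complex_of_real)

lemma L2_inner_cong_AE: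
  assumes "f \<in> L2" "g \<in> L2" "f' \<in> L2" "g' \<in> L2"
    and "AE x in lborel. f x = f' x" "AE x in lborel. g x = g' x"
  shows "L2_inner f g = L2_inner f' g'"
  unfolding L2_inner_def
  using assms by (intro integral_cong_AE borel_measurable_integrable L2_integrable_mult) auto

lemma L2_norm_square: "(L2_norm f)\<^sup>2 = (LINT x|lborel. (cmod (f x))\<^sup>2)"
  by (simp add: L2_norm_def)

lemma L2_norm_square_add:
  assumes f: "f \<in> L2" and g: "g \<in> L2" and orth: "L2_inner f g = 0"
  shows "(L2_norm (\<lambda>x. f x + g x))\<^sup>2 = (L2_norm f)\<^sup>2 + (L2_norm g)\<^sup>2"
proof -
  have orth': "L2_inner g f = 0"
    using orth L2_inner_commute[of g f] by simp
  let ?h = "\<lambda>x. f x + g x"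
  have h: "?h \<in> L2"
    using f g by auto
  have "L2_inner ?h ?h = L2_inner f f + L2_inner g g"
    using L2_inner_commute[of ?h f] L2_inner_commute[of ?h g] f g h orth orth'
    by (simp add: L2_inner_add_right flip: L2_inner_commute)
  then have "complex_of_real ((L2_norm ?h)\<^sup>2) = of_real ((L2_norm f)\<^sup>2 + (L2_norm g)\<^sup>2)"
    by (simp only: L2_inner_self L2_norm_square of_real_add)
  then show ?thesis
    unfolding of_real_eq_iff .
qed

lemma AE_zero_if_L2_norm_zero:
  assumes "f \<in> L2" "L2_norm f = 0"
  shows "AE x in lborel. f x = 0"
  using assms integral_nonneg_eq_0_iff_AE[of lborel "\<lambda>x. (cmod (f x))\<^sup>2"]
  by (simp add: L2_norm_def L2_def)

section \<open>Finite orthonormal systems and Bessel's inequality\<close>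

locale L2_orthonormal =
  fixes I :: "'i set" and e :: "'i \<Rightarrow> real \<Rightarrow> complex"
  assumes finite_index [simp]: "finite I"
    and in_L2: "i \<in> I \<Longrightarrow> e i \<in> L2"
    and orthonormal: "i \<in> I \<Longrightarrow> j \<in> I \<Longrightarrow> L2_inner (e i) (e j) = (if i = j then 1 else 0)"
begin

definition proj :: "(real \<Rightarrow> complex) \<Rightarrow> real \<Rightarrow> complex" where
  "proj f = (\<lambda>x. \<Sum>i\<in>I. L2_inner (e i) f * e i x)"

lemma proj_L2: "proj f \<in> L2"
  unfolding proj_def using in_L2 by (rule L2_lin_comb)

lemma inner_proj: "j \<in> I \<Longrightarrow> L2_inner (e j) (proj f) = L2_inner (e j) f"
  unfolding proj_def by (simp add: L2_inner_lin_comb_right in_L2 orthonormal if_distrib cong: if_cong)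

lemma inner_residual: "f \<in> L2 \<Longrightarrow> j \<in> I \<Longrightarrow> L2_inner (e j) (\<lambda>x. f x - proj f x) = 0"
  by (simp add: L2_inner_diff_right in_L2 proj_L2 inner_proj)

lemma norm_proj: "(L2_norm (proj f))\<^sup>2 = (\<Sum>i\<in>I. (cmod (L2_inner (e i) f))\<^sup>2)"
proof -
  have "L2_inner (proj f) (proj f) = (\<Sum>i\<in>I. cnj (L2_inner (e i) f) * L2_inner (e i) (proj f))"
    by (subst proj_def) (simp add: L2_inner_lin_comb_left in_L2 proj_L2)
  also have "\<dots> = (\<Sum>i\<in>I. of_real ((cmod (L2_inner (e i) f))\<^sup>2))"
    by (intro sum.cong) (auto simp: inner_proj complex_norm_square mult.commute simp del: of_real_power)
  finally have "complex_of_real ((L2_norm (proj f))\<^sup>2) = of_real (\<Sum>i\<in>I. (cmod (L2_inner (e i) f))\<^sup>2)"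
    by (simp only: L2_inner_self L2_norm_square of_real_sum)
  then show ?thesis
    unfolding of_real_eq_iff .
qed

text \<open>The projection and the residual are orthogonal, so their squared norms add up to that of
  \<open>f\<close>, and the residual's share is nonnegative.\<close>

lemma Bessel:
  assumes f: "f \<in> L2"
  shows "(\<Sum>i\<in>I. (cmod (L2_inner (e i) f))\<^sup>2) \<le> (L2_norm f)\<^sup>2"
proof -
  let ?r = "\<lambda>x. f x - proj f x"
  have r: "?r \<in> L2"
    using f proj_L2 by auto
  have "L2_inner (proj f) ?r = (\<Sum>i\<in>I. cnj (L2_inner (e i) f) * L2_inner (e i) ?r)"
    by (subst proj_def) (simp add: L2_inner_lin_comb_left in_L2 r)
  then have "L2_inner (proj f) ?r = 0"
    using f by (simp add: inner_residual)
  from L2_norm_square_add[OF proj_L2 r this]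
  show ?thesis
    by (simp add: norm_proj)
qed

end

section \<open>Completion of polynomial vectors to paraunitary matrices\<close>

text \<open>The Hermitian inner product of C^N, conjugate linear in the first argument. Vectors are
  functions of which only the values below \<open>N\<close> matter.\<close>

definition cip :: "nat \<Rightarrow> (nat \<Rightarrow> complex) \<Rightarrow> (nat \<Rightarrow> complex) \<Rightarrow> complex" where
  "cip N x y = (\<Sum>r<N. cnj (x r) * y r)"

lemma cip_commute: "cip N y x = cnj (cip N x y)"
  by (simp add: cip_def mult.commute)

lemma cip_self: "cip N x x = of_real (\<Sum>r<N. (cmod (x r))\<^sup>2)"
  by (simp add: cip_def complex_norm_square mult.commute del: of_real_power)

lemma cip_self_eq_0_iff: "cip N x x = 0 \<longleftrightarrow> (\<forall>r<N. x r = 0)"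
  unfolding cip_self of_real_eq_0_iff by (subst sum_nonneg_eq_0_iff) auto

lemma cip_cong: "(\<And>r. r < N \<Longrightarrow> x r = x' r) \<Longrightarrow> (\<And>r. r < N \<Longrightarrow> y r = y' r) \<Longrightarrow> cip N x y = cip N x' y'"
  by (simp add: cip_def)

lemma cip_add_right: "cip N x (\<lambda>r. y r + b * z r) = cip N x y + b * cip N x z"
  by (simp add: cip_def algebra_simps sum.distrib sum_distrib_left)

lemma cip_add_left: "cip N (\<lambda>r. y r + b * z r) x = cip N y x + cnj b * cip N z x"
  by (simp add: cip_def algebra_simps sum.distrib sum_distrib_left)

lemma cip_sum_right: "cip N x (\<lambda>r. \<Sum>l\<in>L. y l r * c l) = (\<Sum>l\<in>L. cip N x (y l) * c l)"
  unfolding cip_def by (simp add: sum_distrib_left sum_distrib_right mult.assoc sum.swap[of _ L])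

lemma cip_zero_left: "(\<And>r. r < N \<Longrightarrow> x r = 0) \<Longrightarrow> cip N x y = 0"
  by (simp add: cip_def)

lemma cip_zero_right: "(\<And>r. r < N \<Longrightarrow> y r = 0) \<Longrightarrow> cip N x y = 0"
  by (simp add: cip_def)

text \<open>The columns of the Householder reflection along \<open>u - c e\<^sub>0\<close>, the first one multiplied by \<open>c\<close>;
  the phase \<open>c\<close> is chosen so that \<open>u\<close> and \<open>c e\<^sub>0\<close> are not close.\<close>

lemma unitary_completion:
  assumes N: "N > 0" and u: "cip N u u = 1"
  obtains W where "\<And>r. W 0 r = u r"
    and "\<And>i j. i < N \<Longrightarrow> j < N \<Longrightarrow> cip N (W i) (W j) = (if i = j then 1 else 0)"
proof -
  define a where "a = complex_of_real (cmod (u 0))"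
  define c where "c = (if u 0 = 0 then 1 else - sgn (u 0))"
  have c: "cnj c * c = 1" "c * cnj c = 1"
    by (auto simp: c_def sgn_div_norm complex_norm_square[symmetric] field_simps power2_eq_square
        simp flip: of_real_power)
  have u0: "u 0 = - c * a"
    by (auto simp: c_def a_def sgn_div_norm scaleR_conv_of_real)
  have a_cnj [simp]: "cnj a = a"
    by (simp add: a_def)
  have a1: "1 + a \<noteq> 0"
  proof -
    have "1 + a = of_real (1 + cmod (u 0))"
      by (simp add: a_def)
    then show ?thesis
      by (metis add_pos_nonneg norm_ge_zero of_real_eq_0_iff order_less_irrefl zero_less_one)
  qed
  define e where "e = (\<lambda>j r :: nat. if r = j then 1 else 0 :: complex)"
  have e_right: "cip N x (e j) = cnj (x j)" if "j < N" for x j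
    using that by (simp add: cip_def e_def if_distrib cong: if_cong)
  have e_left: "cip N (e j) x = x j" if "j < N" for x j
    using e_right[OF that, of x] cip_commute[of N "e j" x] by simp
  define w where "w = (\<lambda>r. u r + (- c) * e 0 r)"
  have uw: "cip N u w = 1 + a"
    unfolding w_def cip_add_right using c N u by (simp add: e_right u0)
  have w0: "w 0 = - c * (1 + a)"
    by (simp add: w_def e_def u0 algebra_simps)
  have ww: "cip N w w = 2 * (1 + a)"
  proof -
    have "cip N w w = cip N u w + cnj (- c) * cip N (e 0) w"
      by (subst w_def) (rule cip_add_left)
    also have "cip N (e 0) w = w 0"
      using N by (rule e_left)
    also have "cip N u w + cnj (- c) * w 0 = (1 + a) + (cnj c * c) * (1 + a)"
      by (simp add: uw w0 algebra_simps)
    finally show ?thesis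
      unfolding c by simp
  qed
  have wj: "w j = u j" if "j \<noteq> 0" for j
    using that by (simp add: w_def e_def)
  \<comment> \<open>Since \<open>cip N w w = 2 * (1 + a)\<close>, the reflection is x - <w,x> / (1 +
    a) w; for \<open>j \<noteq> 0\<close> this is its value at \<open>e j\<close>. It maps
    \<open>u\<close> to \<open>c\<close> times \<open>e 0\<close>, hence \<open>c\<close> times
    \<open>e 0\<close> back to \<open>u\<close>, which explains the first column.\<close>
  define W where "W = (\<lambda>j. if j = 0 then u else (\<lambda>r. e j r + (- cnj (w j) / (1 + a)) * w r))"
  have W0: "cip N u (W j) = 0" if "j < N" "j \<noteq> 0" for j
    using that a1 cip_add_right[of N u "e j" "- cnj (w j) / (1 + a)" w] by (simp add: W_def uw e_right wj)
  have Wij: "cip N (W i) (W j) = e i j" if "i < N" "i \<noteq> 0" "j < N" "j \<noteq> 0" for i j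
  proof -
    let ?b = "\<lambda>i. - cnj (w i) / (1 + a)"
    have Wk: "W k = (\<lambda>r. e k r + ?b k * w r)" if "k \<noteq> 0" for k
      using that by (simp add: W_def)
    have "cip N (W i) (W j) = cip N (e i) (e j) + ?b j * w i + cnj (?b i) * (cnj (w j) + ?b j * (2 * (1 + a)))"
      unfolding Wk[OF \<open>i \<noteq> 0\<close>] Wk[OF \<open>j \<noteq> 0\<close>] cip_add_right cip_add_left
      using that by (simp add: e_left e_right ww) (simp add: algebra_simps)
    also have "?b j * (2 * (1 + a)) = - 2 * cnj (w j)"
      using a1 by (simp add: field_simps)
    also have "cip N (e i) (e j) + ?b j * w i + cnj (?b i) * (cnj (w j) + - 2 * cnj (w j)) = e i j"
      using that by (simp add: e_left) (simp add: e_def)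
    finally show ?thesis .
  qed
  have Wi0: "cip N (W i) u = 0" if "i < N" "i \<noteq> 0" for i
    using W0[OF that] cip_commute[of N "W i" u] by simp
  show ?thesis
  proof
    show "W 0 r = u r" for r
      by (simp add: W_def)
    show "cip N (W i) (W j) = (if i = j then 1 else 0)" if "i < N" "j < N" for i j
    proof -
      consider "i = 0" "j = 0" | "i = 0" "j \<noteq> 0" | "i \<noteq> 0" "j = 0" | "i \<noteq> 0" "j \<noteq> 0"
        by blast
      then show ?thesis
      proof cases
        case 1 then show ?thesis using u by (simp add: W_def)
      next
        case 2 then show ?thesis using W0[of j] that by (simp add: W_def[THEN fun_cong, of 0])
      next
        case 3 then show ?thesis using Wi0[of i] that by (simp add: W_def[THEN fun_cong, of 0])
      next
        case 4 then show ?thesis using Wij[of i j] that by (simp add: e_def)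
      qed
    qed
  qed
qed

text \<open>With \<open>Q\<close> the orthogonal projection onto the line of \<open>q\<close>, this is \<open>(1 - Q) x + Q y\<close>. For \<open>q = 0\<close>
  division by zero makes \<open>Q = 0\<close>, so this case needs no separate treatment.\<close>

definition mix :: "nat \<Rightarrow> (nat \<Rightarrow> complex) \<Rightarrow> (nat \<Rightarrow> complex) \<Rightarrow> (nat \<Rightarrow> complex) \<Rightarrow> nat \<Rightarrow> complex" where
  "mix N q x y = (\<lambda>r. x r + (cip N q y - cip N q x) / cip N q q * q r)"

lemma cip_q_zero: "cip N q q = 0 \<Longrightarrow> cip N q x = 0"
  by (simp add: cip_self_eq_0_iff cip_zero_left)

lemma cip_q_mix: "cip N q (mix N q x y) = cip N q y"
  unfolding mix_def cip_add_right by (cases "cip N q q = 0") (simp_all add: cip_q_zero)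

text \<open>The ranges of 1 - Q and Q are orthogonal. So the contribution of \<open>x\<close>,
  \<open>y\<close> along \<open>q\<close> is removed from their inner product and replaced by that
  of \<open>x'\<close>, \<open>y'\<close>.\<close>

lemma cip_mix:
  "cip N (mix N q x x') (mix N q y y') =
     cip N x y - cnj (cip N q x) * cip N q y / cip N q q + cnj (cip N q x') * cip N q y' / cip N q q"
proof (cases "cip N q q = 0")
  case True
  then show ?thesis
    by (simp add: mix_def)
next
  case False
  have cnj_q: "cnj (cip N q q) = cip N q q"
    using cip_commute[of N q q] by simp
  show ?thesis
    unfolding mix_def cip_add_left cip_add_right cip_commute[of N x q] using False
    by (simp add: cnj_q field_simps)
qed

text \<open>\<open>A i l\<close> is the coefficient of z^l in column \<open>i\<close>. The
  hypothesis on the shifts \<open>k\<close> says that v(z) has norm one on the unit circle; negative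
  shifts follow by conjugation. For \<open>d = 0\<close> the columns form a constant unitary matrix,
  hence the restriction in the last clause.\<close>

lemma paraunitary_completion:
  fixes v :: "nat \<Rightarrow> nat \<Rightarrow> complex"
  assumes N: "N > 0"
    and "\<And>k. (\<Sum>l\<le>d. cip N (v l) (v (l + k))) = (if k = 0 then 1 else 0)"
    and "\<And>l r. l > d \<Longrightarrow> r < N \<Longrightarrow> v l r = 0"
  shows "\<exists>A. (\<forall>l\<le>d. \<forall>r<N. A 0 l r = v l r) \<and>
    (\<forall>z. cmod z = 1 \<longrightarrow> (\<forall>i<N. \<forall>j<N.
       cip N (\<lambda>r. \<Sum>l\<le>d. A i l r * z ^ l) (\<lambda>r. \<Sum>l\<le>d. A j l r * z ^ l) = (if i = j then 1 else 0))) \<and>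
    (d > 0 \<longrightarrow> (\<forall>i. \<exists>c. \<forall>r. A i d r = c * v d r))"
  using assms(2,3)
proof (induction d arbitrary: v)
  case 0
  have "cip N (v 0) (v 0) = 1"
    using "0.prems"(1)[of 0] by simp
  then obtain W where W: "\<And>r. W 0 r = v 0 r"
      "\<And>i j. i < N \<Longrightarrow> j < N \<Longrightarrow> cip N (W i) (W j) = (if i = j then 1 else 0)"
    using unitary_completion[OF N] by blast
  then show ?case
    by (intro exI[of _ "\<lambda>i l. W i"]) auto
next
  case (Suc d)
  define q where "q = v (Suc d)"
  let ?s = "cip N q q"
  \<comment> \<open>The coefficients of (1 - Q + z^(-1) Q) v(z): the component along
    \<open>q\<close> moves down by one degree. No negative power arises because Q annihilates
    \<open>v 0\<close>.\<close>
  define w where "w = (\<lambda>l. mix N q (v l) (v (Suc l)))"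
  have q_v0: "cip N q (v 0) = 0"
  proof -
    \<comment> \<open>For the largest possible shift only the term pairing the lowest with the top
      coefficient survives.\<close>
    have "(\<Sum>l\<le>Suc d. cip N (v l) (v (l + Suc d))) = cip N (v 0) q"
      using Suc.prems(2) by (subst sum.atMost_shift) (simp add: q_def cip_zero_right)
    then show ?thesis
      using Suc.prems(1)[of "Suc d"] cip_commute[of N q "v 0"] by simp
  qed
  \<comment> \<open>The degree drops: at \<open>l = Suc d\<close> the coefficient is (1 - Q)
    \<open>q\<close> = 0, with nothing coming down from above.\<close>
  have w_0: "w l r = 0" if "l > d" "r < N" for l r
  proof (cases "l = Suc d")
    case True
    have "cip N q (v (Suc (Suc d))) = 0"
      using Suc.prems(2) by (simp add: cip_zero_right)
    moreover have "?s = 0 \<Longrightarrow> q r = 0"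
      using that by (simp add: cip_self_eq_0_iff)
    ultimately show ?thesis
      using True that by (cases "?s = 0") (auto simp: w_def mix_def q_def)
  next
    case False
    then show ?thesis
      using that Suc.prems(2) by (simp add: w_def mix_def cip_zero_right)
  qed
  have w_orth: "(\<Sum>l\<le>d. cip N (w l) (w (l + k))) = (if k = 0 then 1 else 0)" for k
  proof -
    \<comment> \<open>By \<open>cip_mix\<close>, the contribution \<open>?f l\<close> along
      \<open>q\<close> is replaced by \<open>?f (Suc l)\<close>, so the change telescopes. Both ends
      vanish: the lower one by \<open>q_v0\<close>, the upper one by the degree of v(z).\<close>
    let ?f = "\<lambda>l. cnj (cip N q (v l)) * cip N q (v (l + k)) / ?s"
    have "(\<Sum>l\<le>d. cip N (w l) (w (l + k))) = (\<Sum>l\<le>Suc d. cip N (w l) (w (l + k)))"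
      using w_0 by (simp add: cip_zero_left)
    also have "\<dots> = (\<Sum>l\<le>Suc d. cip N (v l) (v (l + k)) - (?f l - ?f (Suc l)))"
      by (simp add: w_def cip_mix algebra_simps)
    also have "\<dots> = (\<Sum>l\<le>Suc d. cip N (v l) (v (l + k))) - (?f 0 - ?f (Suc (Suc d)))"
      by (subst sum_subtractf, subst sum_telescope[of ?f]) (rule refl)
    also have "?f 0 - ?f (Suc (Suc d)) = 0"
      using Suc.prems(2) by (simp add: q_v0 cip_zero_right)
    finally show ?thesis
      using Suc.prems(1)[of k] by simp
  qed
  obtain A where A: "\<forall>l\<le>d. \<forall>r<N. A 0 l r = w l r"
      "\<And>z i j. cmod z = 1 \<Longrightarrow> i < N \<Longrightarrow> j < N \<Longrightarrow>
       cip N (\<lambda>r. \<Sum>l\<le>d. A i l r * z ^ l) (\<lambda>r. \<Sum>l\<le>d. A j l r * z ^ l) = (if i = j then 1 else 0)"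
    using Suc.IH[of w, OF w_orth w_0] by blast
  \<comment> \<open>\<open>A'\<close> cuts off the unspecified coefficients above \<open>d\<close>,
    \<open>A''\<close> is multiplication by z. Thus \<open>B\<close> consists of the coefficients of
    (1 - Q + z Q) A(z), where the new factor inverts the one that led from v(z) to w(z).\<close>
  define A' where "A' = (\<lambda>i l r. if l \<le> d then A i l r else 0)"
  define A'' where "A'' = (\<lambda>i l. case l of 0 \<Rightarrow> (\<lambda>r. 0) | Suc l \<Rightarrow> A' i l)"
  define B where "B = (\<lambda>i l. mix N q (A' i l) (A'' i l))"
  let ?P = "\<lambda>i z r. \<Sum>l\<le>d. A i l r * z ^ l"
  have P1: "(\<Sum>l\<le>Suc d. A' i l r * z ^ l) = ?P i z r" for i z r
    by (simp add: A'_def)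
  have P2: "(\<Sum>l\<le>Suc d. A'' i l r * z ^ l) = z * ?P i z r" for i z r
    by (subst sum.atMost_Suc_shift) (simp add: A''_def A'_def sum_distrib_left mult_ac)
  have B_poly: "(\<Sum>l\<le>Suc d. B i l r * z ^ l) = mix N q (?P i z) (\<lambda>r. z * ?P i z r) r" for i z r
  proof -
    have "(\<Sum>l\<le>Suc d. B i l r * z ^ l) = (\<Sum>l\<le>Suc d. A' i l r * z ^ l) +
        ((\<Sum>l\<le>Suc d. cip N q (A'' i l) * z ^ l) - (\<Sum>l\<le>Suc d. cip N q (A' i l) * z ^ l)) / ?s * q r"
      unfolding B_def mix_def sum_distrib_right sum_divide_distrib sum_subtractf[symmetric] sum.distrib[symmetric]
      by (intro sum.cong refl) (simp add: field_simps diff_divide_distrib)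
    then show ?thesis
      by (simp only: cip_sum_right[symmetric] P1 P2 mix_def)
  qed
  have A'0: "A' 0 l r = w l r" if "r < N" for l r
    using A(1) w_0 that by (auto simp: A'_def)
  have qA'0: "cip N q (A' 0 l) = cip N q (v (Suc l))" for l
  proof -
    have "cip N q (A' 0 l) = cip N q (w l)"
      using A'0 by (intro cip_cong) auto
    then show ?thesis
      by (simp add: w_def cip_q_mix)
  qed
  \<comment> \<open>Shifting up restores the component along \<open>q\<close> that was shifted down;
    the case \<open>l = 0\<close> is where \<open>q_v0\<close> enters again.\<close>
  have qA''0: "cip N q (A'' 0 l) = cip N q (v l)" for l
    by (cases l) (auto simp: A''_def qA'0 q_v0 cip_zero_right)
  show ?case
  proof (intro exI[of _ B] conjI allI impI)
    show "B 0 l r = v l r" if "r < N" for l r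
      unfolding B_def mix_def qA'0 qA''0 A'0[OF that] w_def
      by (simp add: diff_divide_distrib left_diff_distrib)
    show "\<exists>c. \<forall>r. B i (Suc d) r = c * v (Suc d) r" for i
    proof -
      \<comment> \<open>In degree \<open>Suc d\<close> only the Q part of \<open>mix\<close>
        remains, a multiple of \<open>q\<close>.\<close>
      have "A' i (Suc d) = (\<lambda>r. 0)"
        by (simp add: A'_def)
      then show ?thesis
        unfolding B_def mix_def q_def[symmetric] by (metis add_0)
    qed
    fix z :: complex and i j
    assume z: "cmod z = 1" and ij: "i < N" "j < N"
    have cz: "cip N q (\<lambda>r. z * ?P i z r) = z * cip N q (?P i z)" for i
      by (simp add: cip_def sum_distrib_left mult_ac)
    have zz: "cnj z * z = 1"
      using z by (simp add: complex_norm_square[symmetric] mult.commute[of "cnj z"])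
    \<comment> \<open>The correction carries the factor |z|^2 - 1: on the unit circle 1 - Q + z Q is
      unitary.\<close>
    have "cip N (\<lambda>r. \<Sum>l\<le>Suc d. B i l r * z ^ l) (\<lambda>r. \<Sum>l\<le>Suc d. B j l r * z ^ l)
        = cip N (?P i z) (?P j z) + (cnj z * z - 1) * (cnj (cip N q (?P i z)) * cip N q (?P j z) / ?s)"
      by (simp only: B_poly cip_mix cz) (simp add: algebra_simps diff_divide_distrib)
    then show "cip N (\<lambda>r. \<Sum>l\<le>Suc d. B i l r * z ^ l) (\<lambda>r. \<Sum>l\<le>Suc d. B j l r * z ^ l)
        = (if i = j then 1 else 0)"
      using A(2)[OF z ij] by (simp add: zz)
  qed
qed

section \<open>Fourier transforms of compactly supported functions\<close>

lemma integrable_indicator_Icc: "integrable lborel (indicat_real {a..b :: real})"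
  by (rule integrable_real_indicator) (auto simp: emeasure_lborel_Icc_eq)

text \<open>On the bounded interval |f| is dominated by 1 + |f|^2.\<close>

lemma L2_integrable_if_supported:
  assumes f: "f \<in> L2" and supp: "supported_in f {a..b}"
  shows "integrable lborel f"
proof (rule Bochner_Integration.integrable_bound)
  show "integrable lborel (\<lambda>x. indicator {a..b} x + (cmod (f x))\<^sup>2 :: real)"
    using f by (intro Bochner_Integration.integrable_add integrable_indicator_Icc) (auto simp: L2_def)
  have le: "y \<le> 1 + y\<^sup>2" for y :: real
    using sum_squares_bound[of y 1] zero_le_power2[of y] by (smt (verit) power2_eq_square one_power2)
  show "AE x in lborel. norm (f x) \<le> norm (indicator {a..b} x + (cmod (f x))\<^sup>2 :: real)"
    using supp unfolding supported_in_def by eventually_elim (use le in \<open>auto split: split_indicator\<close>)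
qed (use f in \<open>simp add: L2_def\<close>)

lemma fourier_L1_measurable [measurable]:
  assumes [measurable]: "f \<in> borel_measurable borel"
  shows "fourier_L1 f \<in> borel_measurable borel"
  unfolding fourier_L1_def by measurable

section \<open>Orthonormal systems of exponentials on an interval\<close>

lemma integral_exp_period:
  fixes a b \<alpha> :: real
  assumes "a \<le> b" "\<alpha> \<noteq> 0" "exp (\<i> * of_real (\<alpha> * a)) = exp (\<i> * of_real (\<alpha> * b))"
  shows "(LINT x|lborel. indicator {a..b} x *\<^sub>R exp (\<i> * of_real (\<alpha> * x))) = 0"
proof -
  let ?F = "\<lambda>x :: real. exp (\<i> * of_real (\<alpha> * x)) / (\<i> * of_real \<alpha>)"
  have "(LINT x|lborel. indicator {a..b} x *\<^sub>R exp (\<i> * of_real (\<alpha> * x))) = ?F b - ?F a"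
  proof (rule integral_FTC_Icc)
    show "(?F has_vector_derivative exp (\<i> * of_real (\<alpha> * x))) (at x within {a..b})" for x
    proof -
      have "((\<lambda>z. exp (\<i> * (of_real \<alpha> * z)) / (\<i> * of_real \<alpha>)) has_field_derivative exp (\<i> * (of_real \<alpha> * of_real x)))
          (at (of_real x))"
        using assms by (auto intro!: derivative_eq_intros simp: field_simps)
      from has_vector_derivative_real_field[OF this] show ?thesis
        by (simp add: has_vector_derivative_at_within)
    qed
  qed (use assms in \<open>auto intro!: continuous_intros\<close>)
  then show ?thesis
    using assms by simp
qed

text \<open>Frequencies spaced by \<open>\<delta>\<close> are orthogonal on an interval of length 2
  pi / \<open>\<delta>\<close>. The offset \<open>s\<close> allows the frequencies to sweep the
  whole line as \<open>s\<close> runs through an interval of length \<open>\<delta>\<close>.\<close>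

definition exp_basis :: "real \<Rightarrow> real \<Rightarrow> int \<Rightarrow> real \<Rightarrow> complex" where
  "exp_basis \<delta> s k = (\<lambda>x. of_real (sqrt (\<delta> / (2 * pi))) *
     (indicator {- pi / \<delta>..pi / \<delta>} x *\<^sub>R exp (\<i> * of_real ((s + of_int k * \<delta>) * x))))"

lemma exp_basis_measurable [measurable]: "exp_basis \<delta> s k \<in> borel_measurable borel"
  unfolding exp_basis_def by measurable

lemma exp_basis_mult:
  assumes "\<delta> > 0"
  shows "cnj (exp_basis \<delta> s j x) * exp_basis \<delta> s k x =
    of_real (\<delta> / (2 * pi)) * (indicator {- pi / \<delta>..pi / \<delta>} x *\<^sub>R exp (\<i> * of_real ((of_int (k - j) * \<delta>) * x)))"
proof -
  have "complex_of_real (sqrt (\<delta> / (2 * pi))) * of_real (sqrt (\<delta> / (2 * pi))) = of_real (\<delta> / (2 * pi))"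
    using assms unfolding of_real_mult[symmetric] by simp
  moreover have "cnj (exp (\<i> * of_real ((s + of_int j * \<delta>) * x))) * exp (\<i> * of_real ((s + of_int k * \<delta>) * x))
      = exp (\<i> * of_real ((of_int (k - j) * \<delta>) * x))"
    by (simp add: exp_cnj mult_exp_exp algebra_simps)
  moreover have "cnj (c * (y *\<^sub>R u)) * (c' * (y *\<^sub>R w)) = (cnj c * c') * (y *\<^sub>R (cnj u * w))"
    if "y = 0 \<or> y = 1" for c c' u w :: complex and y :: real
    using that by auto
  moreover have "indicat_real S x = 0 \<or> indicat_real S x = 1" for S
    by (simp split: split_indicator)
  ultimately show ?thesis
    unfolding exp_basis_def by (simp only: complex_cnj_complex_of_real)
qed

lemma exp_basis_L2:
  assumes "\<delta> > 0"
  shows "exp_basis \<delta> s k \<in> L2"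
proof -
  have "(\<lambda>x. (cmod (exp_basis \<delta> s k x))\<^sup>2) = (\<lambda>x. \<delta> / (2 * pi) * indicator {- pi / \<delta>..pi / \<delta>} x)"
    using assms by (auto simp: exp_basis_def fun_eq_iff norm_mult power_mult_distrib split: split_indicator)
  moreover have "integrable lborel (\<lambda>x. \<delta> / (2 * pi) * indicator {- pi / \<delta>..pi / \<delta>} x :: real)"
    by (intro integrable_mult_right integrable_indicator_Icc)
  ultimately show ?thesis
    by (simp add: L2_def)
qed

lemma exp_basis_orthonormal:
  assumes "\<delta> > 0"
  shows "L2_orthonormal {- int K..int K} (exp_basis \<delta> s)"
proof (unfold_locales, goal_cases)
  case (3 j k)
  have "L2_inner (exp_basis \<delta> s j) (exp_basis \<delta> s k) = of_real (\<delta> / (2 * pi)) *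
      (LINT x|lborel. indicator {- pi / \<delta>..pi / \<delta>} x *\<^sub>R exp (\<i> * of_real ((of_int (k - j) * \<delta>) * x)))"
    unfolding L2_inner_def exp_basis_mult[OF assms] by (rule integral_mult_right_zero)
  also have "\<dots> = (if j = k then 1 else 0)"
  proof (cases "j = k")
    case True
    have "(LINT x|lborel. indicator {- pi / \<delta>..pi / \<delta>} x *\<^sub>R (1 :: complex)) = of_real (2 * pi / \<delta>)"
      using assms by (simp add: scaleR_conv_of_real measure_lborel_Icc)
    then show ?thesis
      using True assms by simp
  next
    case False
    have "exp (\<i> * of_real ((of_int (k - j) * \<delta>) * (- pi / \<delta>))) = exp (\<i> * of_real ((of_int (k - j) * \<delta>) * (pi / \<delta>)))"
    proof (rule exp_eq[THEN iffD2], intro exI[of _ "j - k"])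
      show "\<i> * of_real ((of_int (k - j) * \<delta>) * (- pi / \<delta>)) =
          \<i> * of_real ((of_int (k - j) * \<delta>) * (pi / \<delta>)) + of_real (of_int (2 * (j - k)) * pi) * \<i>"
        using assms by (simp add: algebra_simps)
    qed
    then have "(LINT x|lborel. indicator {- pi / \<delta>..pi / \<delta>} x *\<^sub>R exp (\<i> * of_real ((of_int (k - j) * \<delta>) * x))) = 0"
      using False assms by (intro integral_exp_period) auto
    then show ?thesis
      using False by simp
  qed
  finally show ?case .
qed (use assms exp_basis_L2 in auto)

text \<open>Turns Bessel's inequality into a bound on samples of the Fourier transform. On the
  support of \<open>f\<close> the cutoff in \<open>exp_basis\<close> is invisible.\<close>

lemma L2_inner_exp_basis:
  assumes \<delta>: "\<delta> > 0" and [measurable]: "f \<in> borel_measurable borel"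
    and supp: "supported_in f {- pi / \<delta>..pi / \<delta>}"
  shows "L2_inner (exp_basis \<delta> s k) f = of_real (sqrt \<delta>) * fourier_L1 f (s + of_int k * \<delta>)"
proof -
  let ?t = "s + of_int k * \<delta>"
  have "L2_inner (exp_basis \<delta> s k) f =
      (LINT x|lborel. of_real (sqrt (\<delta> / (2 * pi))) * (exp (- \<i> * of_real (?t * x)) * f x))"
    unfolding L2_inner_def
  proof (rule integral_cong_AE)
    show "AE x in lborel. cnj (exp_basis \<delta> s k x) * f x =
        of_real (sqrt (\<delta> / (2 * pi))) * (exp (- \<i> * of_real (?t * x)) * f x)"
      using supp unfolding supported_in_def
      by eventually_elim (auto simp: exp_basis_def exp_cnj indicator_def)
  qed simp_all
  also have "\<dots> = of_real (sqrt (\<delta> / (2 * pi))) * (LINT x|lborel. exp (- \<i> * of_real (?t * x)) * f x)"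
    by (rule integral_mult_right_zero)
  also have "sqrt (\<delta> / (2 * pi)) = sqrt \<delta> * (2 * pi) powr (- 1 / 2)"
  proof -
    have *: "(2 * pi) powr (- 1 / 2) = inverse (sqrt (2 * pi))"
      by (subst minus_divide_left[symmetric], subst powr_minus, subst powr_half_sqrt) auto
    show ?thesis
      unfolding real_sqrt_divide * by (rule divide_inverse)
  qed
  finally show ?thesis
    by (simp add: fourier_L1_def mult.assoc)
qed

text \<open>Bessel's inequality for the exponentials with frequencies \<open>s + k \<delta>\<close>, integrated over
  \<open>0 \<le> s \<le> \<delta>\<close>.\<close>

lemma fourier_L1_nn_integral_le:
  assumes \<delta>: "\<delta> > 0" and f: "f \<in> L2" and supp: "supported_in f {- pi / \<delta>..pi / \<delta>}"
  shows "(\<integral>\<^sup>+t. ennreal ((cmod (fourier_L1 f t))\<^sup>2) \<partial>lborel) \<le> ennreal ((L2_norm f)\<^sup>2)"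
proof -
  define h where "h = (\<lambda>t. ennreal ((cmod (fourier_L1 f t))\<^sup>2))"
  have [measurable]: "f \<in> borel_measurable borel"
    using f by (rule L2_measurable)
  have h_meas [measurable]: "h \<in> borel_measurable borel"
    unfolding h_def by measurable
  have sum_le: "(\<Sum>k\<in>{- int K..int K}. h (s + of_int k * \<delta>)) \<le> ennreal ((L2_norm f)\<^sup>2 / \<delta>)" for s K
  proof -
    interpret L2_orthonormal "{- int K..int K}" "exp_basis \<delta> s"
      using \<delta> by (rule exp_basis_orthonormal)
    have "\<delta> * (\<Sum>k\<in>{- int K..int K}. (cmod (fourier_L1 f (s + of_int k * \<delta>)))\<^sup>2) \<le> (L2_norm f)\<^sup>2"
      using Bessel[OF f] \<delta> supp by (simp add: L2_inner_exp_basis norm_mult power_mult_distrib sum_distrib_left)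
    then show ?thesis
      using \<delta> by (simp add: h_def sum_ennreal ennreal_leI field_simps)
  qed
  have part: "(\<integral>\<^sup>+t. indicator {- real K * \<delta>..real K * \<delta>} t * h t \<partial>lborel) \<le> ennreal ((L2_norm f)\<^sup>2)" for K
  proof -
    \<comment> \<open>The translates of [0, \<open>\<delta>\<close>] by the multiples of
      \<open>\<delta>\<close> with index from \<open>- K\<close> to \<open>K\<close> cover the
      interval; the index \<open>K\<close> takes care of the right endpoint.\<close>
    have "(\<integral>\<^sup>+t. indicator {- real K * \<delta>..real K * \<delta>} t * h t \<partial>lborel) \<le>
        (\<integral>\<^sup>+t. (\<Sum>k\<in>{- int K..int K}. indicator {0..\<delta>} (t - of_int k * \<delta>) * h t) \<partial>lborel)"
    proof (rule nn_integral_mono)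
      fix t
      show "indicator {- real K * \<delta>..real K * \<delta>} t * h t \<le>
          (\<Sum>k\<in>{- int K..int K}. indicator {0..\<delta>} (t - of_int k * \<delta>) * h t)"
      proof (cases "t \<in> {- real K * \<delta>..real K * \<delta>}")
        case True
        define k where "k = \<lfloor>t / \<delta>\<rfloor>"
        have "- real K \<le> t / \<delta>" "t / \<delta> \<le> real K"
          using True \<delta> by (auto simp: field_simps)
        then have k: "k \<in> {- int K..int K}"
          by (auto simp: k_def le_floor_iff floor_le_iff)
        have "of_int k \<le> t / \<delta>" "t / \<delta> \<le> of_int k + 1"
          unfolding k_def by linarith+
        then have "t - of_int k * \<delta> \<in> {0..\<delta>}"
          using \<delta> by (auto simp: field_simps)
        then have "indicator {- real K * \<delta>..real K * \<delta>} t * h t = indicator {0..\<delta>} (t - of_int k * \<delta>) * h t"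
          using True by simp
        also have "\<dots> \<le> (\<Sum>k\<in>{- int K..int K}. indicator {0..\<delta>} (t - of_int k * \<delta>) * h t)"
          using k by (intro member_le_sum) auto
        finally show ?thesis .
      qed simp
    qed
    also have "\<dots> = (\<Sum>k\<in>{- int K..int K}. \<integral>\<^sup>+t. indicator {0..\<delta>} (t - of_int k * \<delta>) * h t \<partial>lborel)"
      by (intro nn_integral_sum) measurable
    also have "\<dots> = (\<Sum>k\<in>{- int K..int K}. \<integral>\<^sup>+s. indicator {0..\<delta>} s * h (s + of_int k * \<delta>) \<partial>lborel)"
    proof (intro sum.cong refl)
      fix k
      show "(\<integral>\<^sup>+t. indicator {0..\<delta>} (t - of_int k * \<delta>) * h t \<partial>lborel) =
          (\<integral>\<^sup>+s. indicator {0..\<delta>} s * h (s + of_int k * \<delta>) \<partial>lborel)"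
        by (subst nn_integral_real_affine[of _ 1 "of_int k * \<delta>"]) (auto simp: add.commute)
    qed
    also have "\<dots> = (\<integral>\<^sup>+s. (\<Sum>k\<in>{- int K..int K}. indicator {0..\<delta>} s * h (s + of_int k * \<delta>)) \<partial>lborel)"
      by (intro nn_integral_sum[symmetric]) measurable
    \<comment> \<open>All pieces now live on the same interval, so \<open>sum_le\<close> applies for
      each \<open>s\<close>. The length \<open>\<delta>\<close> of the interval cancels the
      denominator.\<close>
    also have "\<dots> \<le> (\<integral>\<^sup>+s. ennreal ((L2_norm f)\<^sup>2 / \<delta>) * indicator {0..\<delta>} s \<partial>lborel)"
    proof (rule nn_integral_mono)
      fix s
      show "(\<Sum>k\<in>{- int K..int K}. indicator {0..\<delta>} s * h (s + of_int k * \<delta>))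
          \<le> ennreal ((L2_norm f)\<^sup>2 / \<delta>) * indicator {0..\<delta>} s"
        unfolding sum_distrib_left[symmetric] using sum_le[of s K] by (auto split: split_indicator)
    qed
    also have "\<dots> = ennreal ((L2_norm f)\<^sup>2)"
      using \<delta> by (simp add: nn_integral_cmult_indicator flip: ennreal_mult)
    finally show ?thesis .
  qed
  \<comment> \<open>The bound is uniform in \<open>K\<close>, so monotone convergence carries it
    over to the whole line.\<close>
  have "(\<integral>\<^sup>+t. h t \<partial>lborel) = (\<integral>\<^sup>+t. (SUP K. indicator {- real K * \<delta>..real K * \<delta>} t * h t) \<partial>lborel)"
  proof (rule nn_integral_cong)
    fix t
    obtain K where "\<bar>t\<bar> / \<delta> \<le> real K"
      using real_arch_simple by blast
    then have t: "t \<in> {- real K * \<delta>..real K * \<delta>}"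
      using \<delta> by (auto simp: field_simps abs_le_iff)
    have "h t \<le> (SUP K. indicator {- real K * \<delta>..real K * \<delta>} t * h t)"
      by (rule SUP_upper2[of K]) (use t in auto)
    moreover have "(SUP K. indicator {- real K * \<delta>..real K * \<delta>} t * h t) \<le> h t"
      by (rule SUP_least) (auto split: split_indicator)
    ultimately show "h t = (SUP K. indicator {- real K * \<delta>..real K * \<delta>} t * h t)"
      by (rule antisym)
  qed
  also have "\<dots> = (SUP K. \<integral>\<^sup>+t. indicator {- real K * \<delta>..real K * \<delta>} t * h t \<partial>lborel)"
  proof (rule nn_integral_monotone_convergence_SUP)
    show "incseq (\<lambda>K t. indicator {- real K * \<delta>..real K * \<delta>} t * h t)"
    proof (intro incseq_SucI le_funI)
      fix K t
      have "{- real K * \<delta>..real K * \<delta>} \<subseteq> {- real (Suc K) * \<delta>..real (Suc K) * \<delta>}"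
        using \<delta> by (auto simp: algebra_simps)
      then show "indicator {- real K * \<delta>..real K * \<delta>} t * h t
          \<le> indicator {- real (Suc K) * \<delta>..real (Suc K) * \<delta>} t * h t"
        by (auto split: split_indicator)
    qed
  qed measurable
  also have "\<dots> \<le> ennreal ((L2_norm f)\<^sup>2)"
    using part by (rule SUP_least)
  finally show ?thesis
    by (simp add: h_def)
qed

lemma supported_in_mono: "supported_in f S \<Longrightarrow> S \<subseteq> T \<Longrightarrow> supported_in f T"
  unfolding supported_in_def by (erule eventually_mono) auto

text \<open>Such an \<open>f\<close> is itself integrable and its transform lies in
  \<open>L2\<close>, so the constant sequence witnesses membership in the closed graph.\<close>

lemma is_fourier_fourier_L1:
  assumes f: "f \<in> L2" and supp: "supported_in f {a..b}"
  shows "is_fourier f (fourier_L1 f)"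
proof -
  \<comment> \<open>Makes pi / \<open>\<delta>\<close> equal to 1 + |a| + |b|, so the symmetric
    interval contains the support.\<close>
  define \<delta> where "\<delta> = pi / (1 + \<bar>a\<bar> + \<bar>b\<bar>)"
  have \<delta>: "\<delta> > 0"
    unfolding \<delta>_def by (intro divide_pos_pos) auto
  have "supported_in f {- pi / \<delta>..pi / \<delta>}"
    using supp by (rule supported_in_mono) (auto simp: \<delta>_def)
  from fourier_L1_nn_integral_le[OF \<delta> f this]
  have "(\<integral>\<^sup>+t. ennreal ((cmod (fourier_L1 f t))\<^sup>2) \<partial>lborel) < \<infinity>"
    by (simp add: le_less_trans)
  moreover have [measurable]: "fourier_L1 f \<in> borel_measurable borel"
    using f by (intro fourier_L1_measurable L2_measurable)
  ultimately have "fourier_L1 f \<in> L2"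
    by (simp add: L2_def integrable_iff_bounded)
  then show ?thesis
    unfolding is_fourier_def using f L2_integrable_if_supported[OF f supp]
    by (intro exI[of _ "\<lambda>_. f"]) (auto simp: L2_tendsto_def L2_norm_def)
qed

section \<open>The refinement equation\<close>

lemma lin_comb_in_lin_span_orthogonal:
  assumes f: "f \<in> lin_span S" and S: "S \<subseteq> L2" and h: "h \<in> L2"
    and orth: "\<And>e. e \<in> S \<Longrightarrow> L2_inner h e = 0"
  shows "L2_inner h f = 0"
proof -
  obtain F c where F: "f = (\<lambda>x. \<Sum>e\<in>F. c e * e x)" "F \<subseteq> S"
    using f by (auto simp: lin_span_def)
  \<comment> \<open>The functions in \<open>F\<close> index themselves, so the family is
    \<open>id\<close>.\<close>
  then have "L2_inner h (\<lambda>x. \<Sum>e\<in>F. c e * id e x) = (\<Sum>e\<in>F. c e * L2_inner h (id e))"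
    using S h by (intro L2_inner_lin_comb_right) auto
  then show ?thesis
    using F orth by (auto intro!: sum.neutral)
qed

lemma lin_span_L2: "S \<subseteq> L2 \<Longrightarrow> f \<in> lin_span S \<Longrightarrow> f \<in> L2"
  by (auto simp: lin_span_def intro!: L2_lin_comb)

text \<open>The residual of the projection is orthogonal to the whole span, hence no longer than the
  distance from \<open>f\<close> to any element of the span.\<close>

lemma closed_span_AE_eq_proj:
  assumes "L2_orthonormal I e" and E: "range e \<subseteq> L2" and f: "f \<in> closed_span (range e)"
    and out: "\<And>k. k \<notin> I \<Longrightarrow> L2_inner (e k) f = 0"
    and e_orth: "\<And>i j. i \<noteq> j \<Longrightarrow> L2_inner (e i) (e j) = 0"
  shows "AE x in lborel. f x = (\<Sum>k\<in>I. L2_inner (e k) f * e k x)"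
proof -
  interpret L2_orthonormal I e
    by fact
  obtain X where X: "\<And>n. X n \<in> lin_span (range e)" "L2_tendsto X f"
    using f by (auto simp: closed_span_def)
  have f_L2: "f \<in> L2" and lim: "(\<lambda>n. L2_norm (\<lambda>x. X n x - f x)) \<longlonglongrightarrow> 0"
    using X by (auto simp: L2_tendsto_def)
  have e_L2: "e k \<in> L2" for k
    using E by auto
  let ?h = "\<lambda>x. f x - proj f x"
  have h: "?h \<in> L2"
    using f_L2 proj_L2 by auto
  have h_orth: "L2_inner ?h (e k) = 0" for k
  proof -
    have "L2_inner (e k) ?h = 0"
    proof (cases "k \<in> I")
      case True
      then show ?thesis
        using f_L2 by (rule inner_residual[rotated])
    next
      case False
      have "L2_inner (e k) (proj f) = (\<Sum>i\<in>I. L2_inner (e i) f * L2_inner (e k) (e i))"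
        unfolding proj_def using e_L2 by (intro L2_inner_lin_comb_right)
      also have "\<dots> = 0"
        using False by (intro sum.neutral ballI) (subst e_orth, auto)
      finally show ?thesis
        using out[OF False] by (simp add: L2_inner_diff_right e_L2 f_L2 proj_L2)
    qed
    then show ?thesis
      using L2_inner_commute[of ?h "e k"] by simp
  qed
  have bound: "(L2_norm ?h)\<^sup>2 \<le> (L2_norm (\<lambda>x. X n x - f x))\<^sup>2" for n
  proof -
    have Xn: "X n \<in> L2"
      using E X(1) by (rule lin_span_L2)
    have "L2_inner ?h (X n) = 0"
      using X(1) E h by (rule lin_comb_in_lin_span_orthogonal) (auto simp: h_orth)
    moreover have "L2_inner ?h (proj f) = (\<Sum>i\<in>I. L2_inner (e i) f * L2_inner ?h (e i))"
      by (subst (2) proj_def) (use e_L2 h in \<open>intro L2_inner_lin_comb_right\<close>)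
    ultimately have "L2_inner ?h (\<lambda>x. proj f x - X n x) = 0"
      by (simp add: L2_inner_diff_right h Xn proj_L2 h_orth)
    then have "(L2_norm (\<lambda>x. ?h x + (proj f x - X n x)))\<^sup>2
        = (L2_norm ?h)\<^sup>2 + (L2_norm (\<lambda>x. proj f x - X n x))\<^sup>2"
      using h Xn proj_L2 by (intro L2_norm_square_add) auto
    moreover have "L2_norm (\<lambda>x. ?h x + (proj f x - X n x)) = L2_norm (\<lambda>x. X n x - f x)"
      by (simp add: L2_norm_def norm_minus_commute)
    ultimately show ?thesis
      by simp
  qed
  have "(\<lambda>n. (L2_norm (\<lambda>x. X n x - f x))\<^sup>2) \<longlonglongrightarrow> 0\<^sup>2"
    using lim by (rule tendsto_power)
  then have "(L2_norm ?h)\<^sup>2 \<le> 0\<^sup>2"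
    by (rule LIMSEQ_le_const) (use bound in blast)
  then have "AE x in lborel. ?h x = 0"
    using h by (intro AE_zero_if_L2_norm_zero) auto
  then show ?thesis
    by eventually_elim (simp add: proj_def)
qed

section \<open>Range of the refinement coefficients\<close>

lemma AE_lborel_affine:
  assumes "AE x in lborel. P x" and "c \<noteq> 0" and "Measurable.pred borel P"
  shows "AE x in lborel. P (t + c * x :: real)"
  using assms AE_borel_affine by blast

text \<open>If the lowest index \<open>n0\<close> of a nonzero coefficient were negative, solving the equation for
  \<open>\<phi> (x - n0)\<close> would propagate the vanishing of \<open>\<phi>\<close> on \<open>x < m\<close> to \<open>x < m + 1\<close>.\<close>

lemma refinement_coeff_negative:
  fixes \<phi> :: "real \<Rightarrow> complex" and I :: "int set"
  assumes [measurable]: "\<phi> \<in> borel_measurable borel"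
    and N: "N \<ge> 1" and fin: "finite I"
    and supp: "AE x in lborel. x < 0 \<longrightarrow> \<phi> x = 0"
    and nonzero: "\<not> (AE x in lborel. \<phi> x = 0)"
    and refine: "AE x in lborel. c * \<phi> (x / real N) = (\<Sum>k\<in>I. b k * \<phi> (x - of_int k))"
    and k: "k \<in> I" "k < 0"
  shows "b k = 0"
proof (rule ccontr)
  assume bk: "b k \<noteq> 0"
  define n0 where "n0 = Min {k \<in> I. b k \<noteq> 0}"
  have fin': "finite {k \<in> I. b k \<noteq> 0}"
    using fin by simp
  have n0: "n0 \<in> I" "b n0 \<noteq> 0"
    using Min_in[OF fin'] k bk unfolding n0_def by blast+
  have n0_le: "n0 \<le> j" if "j \<in> I" "b j \<noteq> 0" for j
    unfolding n0_def using fin' that by (intro Min_le) auto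
  have n0_neg: "n0 \<le> -1"
    using n0_le[OF k(1) bk] k(2) by linarith
  have vanish: "AE y in lborel. y < real m \<longrightarrow> \<phi> y = 0" for m
  proof (induction m)
    case 0
    then show ?case
      using supp by simp
  next
    case (Suc m)
    have 1: "AE y in lborel. \<forall>j\<in>I. y + of_int n0 - of_int j < real m \<longrightarrow> \<phi> (y + of_int n0 - of_int j) = 0"
    proof (rule eventually_ball_finite[rule_format])
      fix j
      show "AE y in lborel. y + of_int n0 - of_int j < real m \<longrightarrow> \<phi> (y + of_int n0 - of_int j) = 0"
        using AE_lborel_affine[OF Suc.IH, of 1 "of_int n0 - of_int j"] by (simp add: algebra_simps)
    qed (rule fin)
    have 2: "AE y in lborel. (y + of_int n0) / real N < real m \<longrightarrow> \<phi> ((y + of_int n0) / real N) = 0"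
      using AE_lborel_affine[OF Suc.IH, of "1 / real N" "of_int n0 / real N"] N
      by (simp add: add_divide_distrib add.commute)
    have 3: "AE y in lborel. c * \<phi> ((y + of_int n0) / real N) = (\<Sum>j\<in>I. b j * \<phi> (y + of_int n0 - of_int j))"
      using AE_lborel_affine[OF refine, of 1 "of_int n0"] by (simp add: add.commute)
    from 1 2 3 show ?case
    proof eventually_elim
      case (elim y)
      show ?case
      proof
        assume y: "y < real (Suc m)"
        have *: "y + of_int n0 < real m"
          using n0_neg y by simp
        \<comment> \<open>Both \<open>m \<ge> 0\<close> and \<open>N \<ge> 1\<close> matter here:
          contraction towards 0 stays below \<open>m\<close>, so the left side of the equation
          vanishes.\<close>
        have "(y + of_int n0) / real N < real m"
        proof -
          have "real m \<le> real m * real N"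
            using N by (simp add: mult_le_cancel_left1)
          then show ?thesis
            using * N by (simp add: divide_less_eq)
        qed
        then have "0 = (\<Sum>j\<in>I. b j * \<phi> (y + of_int n0 - of_int j))"
          using elim(2,3) by simp
        \<comment> \<open>An index \<open>j > n0\<close> with nonzero coefficient has its argument
          at most \<open>y - 1 < m\<close>, where the induction hypothesis gives zero. Only
          \<open>b n0 * \<phi> y\<close> remains.\<close>
        also have "\<dots> = (\<Sum>j\<in>{n0}. b j * \<phi> (y + of_int n0 - of_int j))"
        proof (rule sum.mono_neutral_right)
          show "\<forall>j\<in>I - {n0}. b j * \<phi> (y + of_int n0 - of_int j) = 0"
          proof
            fix j assume j: "j \<in> I - {n0}"
            show "b j * \<phi> (y + of_int n0 - of_int j) = 0"
            proof (cases "b j = 0")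
              case False
              then have "n0 + 1 \<le> j"
                using n0_le[of j] j by auto
              then have "real_of_int n0 + 1 \<le> real_of_int j"
                by linarith
              then show ?thesis
                using elim(1) j y by auto
            qed simp
          qed
        qed (use fin n0 in auto)
        finally show "\<phi> y = 0"
          using n0 by simp
      qed
    qed
  qed
  have "AE y in lborel. \<forall>m. y < real m \<longrightarrow> \<phi> y = 0"
    unfolding AE_all_countable using vanish ..
  then have "AE y in lborel. \<phi> y = 0"
    by eventually_elim (use reals_Archimedean2 in blast)
  with nonzero show False ..
qed

text \<open>The reflected function \<open>x \<mapsto> \<phi> (M - x)\<close> satisfies the refinement equation with the coefficients
  in reverse order, counted from \<open>(N - 1) M\<close>.\<close>

lemma refinement_coeff_large:
  fixes \<phi> :: "real \<Rightarrow> complex" and I :: "int set"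
  assumes [measurable]: "\<phi> \<in> borel_measurable borel"
    and N: "N \<ge> 1" and fin: "finite I"
    and supp: "AE x in lborel. x > real M \<longrightarrow> \<phi> x = 0"
    and nonzero: "\<not> (AE x in lborel. \<phi> x = 0)"
    and refine: "AE x in lborel. c * \<phi> (x / real N) = (\<Sum>k\<in>I. b k * \<phi> (x - of_int k))"
    and k: "k \<in> I" "k > int ((N - 1) * M)"
  shows "b k = 0"
proof -
  define D where "D = int ((N - 1) * M)"
  have D: "real_of_int D = real N * real M - real M"
    using N by (simp add: D_def of_nat_diff algebra_simps)
  have "b (D - (D - k)) = 0"
  proof (rule refinement_coeff_negative[where \<phi> = "\<lambda>x. \<phi> (real M - x)" and I = "(\<lambda>k. D - k) ` I"
        and N = N and c = c and b = "\<lambda>k. b (D - k)"])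
    show "AE x in lborel. x < 0 \<longrightarrow> \<phi> (real M - x) = 0"
      using AE_lborel_affine[OF supp, of "-1" "real M"] by simp
    show "\<not> (AE x in lborel. \<phi> (real M - x) = 0)"
    proof
      assume "AE x in lborel. \<phi> (real M - x) = 0"
      from AE_lborel_affine[OF this, of "-1" "real M"] nonzero show False
        by simp
    qed
    \<comment> \<open>Substituting N M - x for x is the right reflection because N M - x - k = M -
      (x - (D - k)).\<close>
    have "AE x in lborel. c * \<phi> ((real N * real M - x) / real N) = (\<Sum>k\<in>I. b k * \<phi> (real N * real M - x - of_int k))"
      using AE_lborel_affine[OF refine, of "-1" "real N * real M"] by simp
    then show "AE x in lborel. c * \<phi> (real M - x / real N) =
        (\<Sum>k\<in>(\<lambda>k. D - k) ` I. b (D - k) * \<phi> (real M - (x - of_int k)))"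
    proof eventually_elim
      case (elim x)
      have "(real N * real M - x) / real N = real M - x / real N"
        using N by (simp add: field_simps)
      moreover have "(\<Sum>k\<in>(\<lambda>k. D - k) ` I. b (D - k) * \<phi> (real M - (x - of_int k)))
          = (\<Sum>k\<in>I. b k * \<phi> (real N * real M - x - of_int k))"
        by (subst sum.reindex) (auto simp: inj_on_def D algebra_simps)
      ultimately show ?case
        using elim by simp
    qed
  qed (use N fin k in \<open>auto simp: D_def\<close>)
  then show ?thesis
    by simp
qed

text \<open>Disjointness of supports leaves finitely many coefficients, and the two preceding lemmas
  confine them to the range from 0 to (N - 1) M. The last claim expresses that the translates of
  \<open>U_op N \<phi>\<close> by multiples of \<open>N\<close> are orthonormal.\<close>

lemma scaling_function_refinement:
  assumes N: "N \<ge> 2" and sc: "scaling_function N \<phi>" and supp: "supported_in \<phi> {0..real M}"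
  obtains b :: "nat \<Rightarrow> complex"
  where "AE x in lborel. U_op N \<phi> x = (\<Sum>n\<le>(N - 1) * M. b n * \<phi> (x - real n))"
    and "\<And>n. n > (N - 1) * M \<Longrightarrow> b n = 0"
    and "\<And>k. (\<Sum>n\<le>(N - 1) * M. cnj (b n) * b (n + N * k)) = (if k = 0 then 1 else 0)"
proof -
  define D where "D = (N - 1) * M"
  define e where "e = (\<lambda>k :: int. int_funpow T_op k \<phi>)"
  have e: "e k = (\<lambda>x. \<phi> (x - of_int k))" for k
    by (simp add: e_def int_funpow_T_op)
  have \<phi>: "\<phi> \<in> L2"
    using sc by (simp add: scaling_function_def)
  then have \<phi>_meas [measurable]: "\<phi> \<in> borel_measurable borel"
    by (rule L2_measurable)
  have e_L2: "e k \<in> L2" for k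
    using L2_affine[OF \<phi>, of 1 "- of_int k"] by (simp add: e)
  have e_orth: "L2_inner (e k) (e l) = (if k = l then 1 else 0)" for k l
    using sc by (simp add: scaling_function_def e_def)
  have U_V0: "U_op N \<phi> \<in> closed_span (range e)"
    using sc by (simp add: scaling_function_def V0_def e_def)
  have U_L2: "U_op N \<phi> \<in> L2"
    using U_V0 by (auto simp: closed_span_def L2_tendsto_def)
  \<comment> \<open>The translate by \<open>k\<close> lives on [k, k + M] and
    \<open>U_op N \<phi>\<close> on [0, N M]; these intervals are disjoint for \<open>k\<close>
    outside \<open>I\<close>.\<close>
  define I where "I = {- int M..int (N * M)}"
  interpret L2_orthonormal I e
    by unfold_locales (auto simp: I_def e_L2 e_orth)
  define c where "c = (\<lambda>k. L2_inner (e k) (U_op N \<phi>))"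
  have supp_e: "AE x in lborel. x \<notin> {0..real M} \<longrightarrow> \<phi> x = 0"
    using supp by (simp add: supported_in_def)
  have c_out: "c k = 0" if "k \<notin> I" for k
  proof -
    have "AE x in lborel. x - of_int k \<notin> {0..real M} \<longrightarrow> \<phi> (x - of_int k) = 0"
      using AE_lborel_affine[OF supp_e, of 1 "- of_int k"] by simp
    moreover have "AE x in lborel. x / real N \<notin> {0..real M} \<longrightarrow> \<phi> (x / real N) = 0"
      using AE_lborel_affine[OF supp_e, of "1 / real N" 0] N by simp
    ultimately have "AE x in lborel. cnj (e k x) * U_op N \<phi> x = 0"
    proof eventually_elim
      case (elim x)
      show ?case
      proof (rule ccontr)
        assume "cnj (e k x) * U_op N \<phi> x \<noteq> 0"
        then have "x - of_int k \<in> {0..real M}" "x / real N \<in> {0..real M}"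
          using elim by (auto simp: e U_op_def)
        then have "0 \<le> x" "x \<le> real N * real M" "of_int k \<le> x" "x \<le> of_int k + real M"
          using N by (auto simp: field_simps)
        then have "real_of_int (- int M) \<le> of_int k" "real_of_int k \<le> of_int (int (N * M))"
          by auto
        then show False
          using that unfolding I_def of_int_le_iff by auto
      qed
    qed
    then show ?thesis
      unfolding c_def L2_inner_def by (rule integral_eq_zero_AE)
  qed
  have refine: "AE x in lborel. U_op N \<phi> x = (\<Sum>k\<in>I. c k * e k x)"
    unfolding c_def
  proof (rule closed_span_AE_eq_proj)
    show "L2_orthonormal I e" ..
  qed (use U_V0 e_L2 e_orth c_out in \<open>auto simp: c_def\<close>)
  have nonzero: "\<not> (AE x in lborel. \<phi> x = 0)"
  proof
    assume "AE x in lborel. \<phi> x = 0"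
    then have "AE x in lborel. cnj (\<phi> x) * \<phi> x = 0"
      by eventually_elim simp
    then have "L2_inner \<phi> \<phi> = 0"
      unfolding L2_inner_def by (rule integral_eq_zero_AE)
    then show False
      using e_orth[of 0 0] by (simp add: e)
  qed
  have refine': "AE x in lborel. of_real (real N powr (- 1 / 2)) * \<phi> (x / real N) = (\<Sum>k\<in>I. c k * \<phi> (x - of_int k))"
    using refine by (simp add: U_op_def e)
  have c_neg: "c k = 0" if "k < 0" for k
  proof (cases "k \<in> I")
    case True
    show ?thesis
    proof (rule refinement_coeff_negative[OF \<phi>_meas _ _ _ nonzero refine' True that])
      show "AE x in lborel. x < 0 \<longrightarrow> \<phi> x = 0"
        using supp_e by eventually_elim auto
    qed (use N in \<open>auto simp: I_def\<close>)
  qed (rule c_out)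
  have c_large: "c k = 0" if "k > int D" for k
  proof (cases "k \<in> I")
    case True
    show ?thesis
    proof (rule refinement_coeff_large[OF \<phi>_meas _ _ _ nonzero refine' True])
      show "AE x in lborel. x > real M \<longrightarrow> \<phi> x = 0"
        using supp_e by eventually_elim auto
    qed (use N that in \<open>auto simp: I_def D_def\<close>)
  qed (rule c_out)
  define b where "b = (\<lambda>n :: nat. c (int n))"
  have sum_b: "(\<Sum>k\<in>I. c k * e k x) = (\<Sum>n\<le>D. b n * e (int n) x)" for x
  proof -
    have "(\<Sum>k\<in>I. c k * e k x) = (\<Sum>k\<in>int ` {..D}. c k * e k x)"
    proof (rule sum.mono_neutral_right)
      have "D \<le> N * M"
        unfolding D_def by (intro mult_right_mono) auto
      then show "int ` {..D} \<subseteq> I"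
        by (auto simp: I_def simp flip: of_nat_mult)
      show "\<forall>k\<in>I - int ` {..D}. c k * e k x = 0"
      proof
        fix k assume "k \<in> I - int ` {..D}"
        then have "k < 0 \<or> k > int D"
          by (metis DiffD2 atMost_iff imageI linorder_not_le nonneg_int_cases of_nat_le_iff)
        then show "c k * e k x = 0"
          using c_neg c_large by auto
      qed
    qed (simp add: I_def)
    then show ?thesis
      by (simp add: sum.reindex b_def)
  qed
  have b_0: "b n = 0" if "n > D" for n
    using c_large that by (simp add: b_def)
  have refine_b: "AE x in lborel. U_op N \<phi> x = (\<Sum>n\<le>D. b n * e (int n) x)"
    using refine by (simp add: sum_b)
  have b_orth: "(\<Sum>n\<le>D. cnj (b n) * b (n + N * k)) = (if k = 0 then 1 else 0)" for k
  proof -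
    \<comment> \<open>As T^(N k) U = U T^k and U preserves inner products, the product of
      \<open>?F\<close> with \<open>U_op N \<phi>\<close> reduces to that of T^k \<phi> with \<phi>.
      It is then computed a second time from the coefficients.\<close>
    let ?F = "\<lambda>x. U_op N \<phi> (x - real (N * k))"
    have F_L2: "?F \<in> L2"
      using L2_affine[OF U_L2, of 1 "- real (N * k)"] by simp
    have "L2_inner ?F (U_op N \<phi>) = (LINT x|lborel. of_real (1 / real N) * (cnj (\<phi> (x / real N - real k)) * \<phi> (x / real N)))"
      unfolding L2_inner_def
    proof (intro Bochner_Integration.integral_cong refl)
      fix x
      have "complex_of_real (real N powr (- 1 / 2)) * of_real (real N powr (- 1 / 2)) = of_real (1 / real N)"
        unfolding of_real_mult[symmetric] powr_add[symmetric] using N by (simp add: powr_minus_divide)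
      moreover have "(x - real (N * k)) / real N = x / real N - real k"
        using N by (simp add: field_simps)
      ultimately show "cnj (U_op N \<phi> (x - real (N * k))) * U_op N \<phi> x =
          of_real (1 / real N) * (cnj (\<phi> (x / real N - real k)) * \<phi> (x / real N))"
        unfolding U_op_def by (simp add: mult_ac)
    qed
    also have "\<dots> = (LINT x|lborel. cnj (\<phi> (x - real k)) * \<phi> x)"
      using N by (subst lborel_integral_real_affine[of "real N" _ 0]) (auto simp: scaleR_conv_of_real)
    also have "\<dots> = L2_inner (e (int k)) (e 0)"
      by (simp add: L2_inner_def e)
    finally have 1: "L2_inner ?F (U_op N \<phi>) = (if k = 0 then 1 else 0)"
      by (simp add: e_orth)
    have F_refine: "AE x in lborel. ?F x = (\<Sum>n\<le>D. b n * e (int (n + N * k)) x)"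
    proof -
      have "AE x in lborel. U_op N \<phi> (- real (N * k) + 1 * x) =
          (\<Sum>n\<le>D. b n * \<phi> (- real (N * k) + 1 * x - real n))"
        by (rule AE_lborel_affine[OF refine_b[unfolded e of_int_of_nat_eq]]) (simp_all add: U_op_def)
      moreover have "- real (N * k) + 1 * x = x - real (N * k)"
          "x - real (N * k) - real n = x - real_of_int (int (n + N * k))" for x n
        by simp_all
      ultimately show ?thesis
        by (simp only: e)
    qed
    have "L2_inner ?F (U_op N \<phi>) = L2_inner (\<lambda>x. \<Sum>n\<le>D. b n * e (int (n + N * k)) x) (\<lambda>x. \<Sum>n\<le>D. b n * e (int n) x)"
      using F_L2 U_L2 e_L2 F_refine refine_b by (intro L2_inner_cong_AE) auto
    also have "\<dots> = (\<Sum>n\<le>D. cnj (b n) * (\<Sum>m\<le>D. b m * L2_inner (e (int (n + N * k))) (e (int m))))"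
      using e_L2 by (subst L2_inner_lin_comb_left) (auto simp: L2_inner_lin_comb_right)
    also have "\<dots> = (\<Sum>n\<le>D. cnj (b n) * b (n + N * k))"
    proof (intro sum.cong refl)
      fix n
      have "(\<Sum>m\<le>D. b m * L2_inner (e (int (n + N * k))) (e (int m))) = (\<Sum>m\<le>D. if m = n + N * k then b m else 0)"
        by (intro sum.cong refl) (auto simp: e_orth simp flip: of_nat_add of_nat_mult)
      \<comment> \<open>If \<open>n + N * k\<close> exceeds \<open>D\<close>, no index matches and
        the sum is empty, in accordance with \<open>b_0\<close>.\<close>
      also have "\<dots> = b (n + N * k)"
        using b_0 by (simp add: not_le)
      finally show "cnj (b n) * (\<Sum>m\<le>D. b m * L2_inner (e (int (n + N * k))) (e (int m))) = cnj (b n) * b (n + N * k)"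
        by simp
    qed
    finally show ?thesis
      using 1 by simp
  qed
  show ?thesis
    using that[of b] refine_b b_0 b_orth by (simp add: D_def e)
qed

section \<open>Filters\<close>

lemma integrable_exp_mult:
  fixes f :: "real \<Rightarrow> complex"
  assumes "integrable lborel f"
  shows "integrable lborel (\<lambda>x. exp (- \<i> * of_real (t * x)) * f x)"
proof (rule Bochner_Integration.integrable_bound[OF assms])
  have [measurable]: "f \<in> borel_measurable borel"
    using assms by (simp add: integrable_iff_bounded)
  show "(\<lambda>x. exp (- \<i> * of_real (t * x)) * f x) \<in> borel_measurable lborel"
    by simp
qed (simp add: norm_mult)

lemma fourier_L1_translate:
  "fourier_L1 (\<lambda>x. f (x - a)) t = exp (- \<i> * of_real (t * a)) * fourier_L1 f t"
proof -
  have "(LINT x|lborel. exp (- \<i> * of_real (t * x)) * f (x - a)) =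
      (LINT x|lborel. exp (- \<i> * of_real (t * (a + x))) * f x)"
    by (subst lborel_integral_real_affine[of 1 _ a]) auto
  also have "\<dots> = (LINT x|lborel. exp (- \<i> * of_real (t * a)) * (exp (- \<i> * of_real (t * x)) * f x))"
    unfolding mult.assoc[symmetric] mult_exp_exp by (simp add: algebra_simps)
  finally show ?thesis
    unfolding fourier_L1_def by simp
qed

lemma fourier_L1_U_op:
  assumes "N > 0"
  shows "fourier_L1 (U_op N f) t = of_real (sqrt (real N)) * fourier_L1 f (real N * t)"
proof -
  let ?c = "complex_of_real (real N powr (- 1 / 2))"
  have "(LINT x|lborel. exp (- \<i> * of_real (t * x)) * U_op N f x) =
      of_real (real N) * (LINT x|lborel. ?c * (exp (- \<i> * of_real (real N * t * x)) * f x))"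
    using assms unfolding U_op_def
    by (subst lborel_integral_real_affine[of "real N" _ 0]) (auto simp: scaleR_conv_of_real mult_ac)
  also have "\<dots> = (of_real (real N) * ?c) * (LINT x|lborel. exp (- \<i> * of_real (real N * t * x)) * f x)"
    by simp
  also have "of_real (real N) * ?c = of_real (sqrt (real N))"
  proof -
    have "real N * real N powr (- 1 / 2) = real N powr 1 * real N powr (- 1 / 2)"
      using assms by simp
    also have "\<dots> = sqrt (real N)"
      unfolding powr_add[symmetric] using assms by (simp add: powr_half_sqrt)
    finally show ?thesis
      by (metis of_real_mult of_real_of_nat_eq)
  qed
  finally show ?thesis
    by (simp add: fourier_L1_def mult_ac)
qed

lemma fourier_L1_cong_AE:
  assumes [measurable]: "f \<in> borel_measurable borel" "g \<in> borel_measurable borel"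
    and "AE x in lborel. f x = g x"
  shows "fourier_L1 f t = fourier_L1 g t"
proof -
  have "(LINT x|lborel. exp (- \<i> * of_real (t * x)) * f x) = (LINT x|lborel. exp (- \<i> * of_real (t * x)) * g x)"
    using assms by (intro integral_cong_AE) auto
  then show ?thesis
    by (simp add: fourier_L1_def)
qed

lemma fourier_L1_lin_comb:
  assumes "\<And>i. i \<in> I \<Longrightarrow> integrable lborel (f i)"
  shows "fourier_L1 (\<lambda>x. \<Sum>i\<in>I. c i * f i x) t = (\<Sum>i\<in>I. c i * fourier_L1 (f i) t)"
proof -
  let ?E = "\<lambda>x. exp (- \<i> * of_real (t * x))"
  have "(LINT x|lborel. ?E x * (\<Sum>i\<in>I. c i * f i x)) = (LINT x|lborel. (\<Sum>i\<in>I. c i * (?E x * f i x)))"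
    by (simp add: sum_distrib_left mult.left_commute)
  also have "\<dots> = (\<Sum>i\<in>I. LINT x|lborel. c i * (?E x * f i x))"
    using assms by (intro Bochner_Integration.integral_sum integrable_mult_right integrable_exp_mult)
  also have "\<dots> = (\<Sum>i\<in>I. c i * (LINT x|lborel. ?E x * f i x))"
    by simp
  finally show ?thesis
    unfolding fourier_L1_def by (simp add: sum_distrib_left mult_ac)
qed

section \<open>Trigonometric polynomials as filters\<close>

definition trig_poly :: "nat \<Rightarrow> (nat \<Rightarrow> complex) \<Rightarrow> real \<Rightarrow> complex" where
  "trig_poly D b t = (\<Sum>n\<le>D. b n * exp (- \<i> * of_real (t * real n)))"

text \<open>Under the Fourier integral, translation by \<open>n\<close> becomes multiplication by
  e^(-i n t) and \<open>U_op N\<close> a dilation of the frequency. The bounded supports make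
  \<open>fourier_L1\<close> a valid transform on both sides.\<close>

lemma filter_relation_trig_poly:
  assumes N: "N > 0" and \<phi>: "\<phi> \<in> L2" "supported_in \<phi> {a..b}" and \<psi>: "\<psi> \<in> L2" "supported_in \<psi> {a'..b'}"
    and U: "AE x in lborel. U_op N \<psi> x = (\<Sum>n\<le>D. c n * \<phi> (x - real n))"
  shows "filter_relation N \<phi> (trig_poly D c) \<psi>"
  unfolding filter_relation_def
proof (intro exI conjI AE_I2)
  show "is_fourier \<phi> (fourier_L1 \<phi>)" "is_fourier \<psi> (fourier_L1 \<psi>)"
    using \<phi> \<psi> by (auto intro: is_fourier_fourier_L1)
  have [measurable]: "\<phi> \<in> borel_measurable borel" "\<psi> \<in> borel_measurable borel"
    using \<phi> \<psi> by (auto dest: L2_measurable)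
  have int: "integrable lborel (\<lambda>x. \<phi> (x - real n))" for n
    using lborel_integrable_real_affine[OF L2_integrable_if_supported[OF \<phi>], of 1 "- real n"] by simp
  fix t
  have "of_real (sqrt (real N)) * fourier_L1 \<psi> (real N * t) = fourier_L1 (U_op N \<psi>) t"
    using N by (simp add: fourier_L1_U_op)
  also have "\<dots> = fourier_L1 (\<lambda>x. \<Sum>n\<le>D. c n * \<phi> (x - real n)) t"
  proof (rule fourier_L1_cong_AE[OF _ _ U])
    show "U_op N \<psi> \<in> borel_measurable borel"
      unfolding U_op_def by measurable
  qed measurable
  also have "\<dots> = trig_poly D c t * fourier_L1 \<phi> t"
    by (simp add: fourier_L1_lin_comb int fourier_L1_translate trig_poly_def sum_distrib_right mult.assoc)
  finally show "of_real (sqrt (real N)) * fourier_L1 \<psi> (real N * t) = trig_poly D c t * fourier_L1 \<phi> t" .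
qed

lemma periodic_L2_trig_poly: "periodic_L2 (trig_poly D b)"
proof -
  have cont: "continuous_on S (trig_poly D b)" for S
    unfolding trig_poly_def by (intro continuous_intros)
  have "exp (- \<i> * of_real ((t + 2 * pi) * real n)) = exp (- \<i> * of_real (t * real n))" for t n
    by (rule exp_eq[THEN iffD2], rule exI[of _ "- int n"]) (simp add: algebra_simps)
  then have "trig_poly D b (t + 2 * pi) = trig_poly D b t" for t
    by (simp add: trig_poly_def)
  moreover have "set_integrable lborel {0..2 * pi} (\<lambda>t. (cmod (trig_poly D b t))\<^sup>2)"
    unfolding set_integrable_def
    by (intro borel_integrable_compact compact_Icc continuous_intros cont)
  moreover have "trig_poly D b \<in> borel_measurable borel"
    using cont by (rule borel_measurable_continuous_onI)
  ultimately show ?thesis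
    by (simp add: periodic_L2_def)
qed

section \<open>Polyphase decomposition and orthogonality of filters\<close>

lemma sum_polyphase: "(\<Sum>n<Suc d * N. f n) = (\<Sum>l\<le>d. \<Sum>r<N. f (l * N + r))"
  for f :: "nat \<Rightarrow> complex"
proof -
  have "(\<Sum>n<Suc d * N. f n) = (\<Sum>l<Suc d. \<Sum>n\<in>{l * N..<l * N + N}. f n)"
    by (rule sum.nat_group[symmetric])
  also have "\<dots> = (\<Sum>l\<le>d. \<Sum>r<N. f (l * N + r))"
    using sum.shift_bounds_nat_ivl[of f 0 "_ * N" N]
    by (simp add: lessThan_Suc_atMost atLeast0LessThan add.commute)
  finally show ?thesis .
qed

text \<open>The index splits as n = l N + r, with zero coefficients filling the last block of length
  \<open>N\<close>. The inner polynomials depend on \<open>s\<close> only through e^(-i s N), which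
  has period 2 pi / N.\<close>

lemma trig_poly_polyphase:
  assumes D: "D < Suc d * N" and c: "\<And>n. D < n \<Longrightarrow> n < Suc d * N \<Longrightarrow> c n = 0"
  shows "trig_poly D c s = (\<Sum>r<N. exp (- \<i> * of_real (s * real r)) *
     (\<Sum>l\<le>d. c (l * N + r) * exp (- \<i> * of_real (s * real N)) ^ l))"
proof -
  have "trig_poly D c s = (\<Sum>n<Suc d * N. c n * exp (- \<i> * of_real (s * real n)))"
    unfolding trig_poly_def using D c by (intro sum.mono_neutral_left) auto
  also have "\<dots> = (\<Sum>l\<le>d. \<Sum>r<N. exp (- \<i> * of_real (s * real r)) *
      (c (l * N + r) * exp (- \<i> * of_real (s * real N)) ^ l))"
    unfolding sum_polyphase
  proof (intro sum.cong refl)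
    fix l r
    have "exp (- \<i> * of_real (s * real (l * N + r))) =
        exp (- \<i> * of_real (s * real N)) ^ l * exp (- \<i> * of_real (s * real r))"
      unfolding exp_of_nat_mult[symmetric] mult_exp_exp by (simp add: algebra_simps)
    then show "c (l * N + r) * exp (- \<i> * of_real (s * real (l * N + r))) =
        exp (- \<i> * of_real (s * real r)) * (c (l * N + r) * exp (- \<i> * of_real (s * real N)) ^ l)"
      by simp
  qed
  also have "\<dots> = (\<Sum>r<N. exp (- \<i> * of_real (s * real r)) *
      (\<Sum>l\<le>d. c (l * N + r) * exp (- \<i> * of_real (s * real N)) ^ l))"
    by (subst sum.swap) (simp add: sum_distrib_left)
  finally show ?thesis .
qed

text \<open>Orthogonality of the characters of Z/N: for \<open>r \<noteq> s\<close> the terms form a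
  geometric progression whose ratio is an \<open>N\<close>-th root of unity, different from 1
  because 0 < |r - s| < N.\<close>

lemma sum_exp_roots_of_unity:
  assumes "r < N" "s < N"
  shows "(\<Sum>k<N. cnj (exp (- \<i> * of_real ((t + 2 * pi * real k / real N) * real r))) *
      exp (- \<i> * of_real ((t + 2 * pi * real k / real N) * real s))) = (if r = s then of_nat N else 0)"
proof (cases "r = s")
  case True
  have "cnj (exp (- \<i> * of_real x)) * exp (- \<i> * of_real x) = 1" for x
    by (simp add: exp_cnj mult_exp_exp)
  then show ?thesis
    using True by (simp only:) simp
next
  case False
  define w where "w = exp (\<i> * of_real (2 * pi * (real r - real s) / real N))"
  have "w \<noteq> 1"
  proof
    assume "w = 1"
    then obtain n :: int where "2 * pi * (real r - real s) / real N = of_int (2 * n) * pi"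
      unfolding w_def exp_eq_1 by auto
    then have "(2 * pi) * ((real r - real s) / real N) = (2 * pi) * of_int n"
      by simp
    then have "(real r - real s) / real N = of_int n"
      by (subst (asm) mult_cancel_left) simp
    then have "real r - real s = of_int n * real N"
      using assms by (simp add: field_simps)
    then have "real_of_int (int r - int s) = of_int (n * int N)"
      by simp
    then have "int r - int s = n * int N"
      unfolding of_int_eq_iff .
    then have "int N dvd int r - int s"
      by simp
    then have "int r mod int N = int s mod int N"
      by (simp add: mod_eq_dvd_iff)
    then show False
      using assms False by simp
  qed
  have "of_nat N * (\<i> * of_real (2 * pi * (real r - real s) / real N)) = 2 * of_int (int r - int s) * of_real pi * \<i>"
    using assms by (simp add: field_simps)
  then have "w ^ N = exp (2 * of_int (int r - int s) * of_real pi * \<i>)"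
    unfolding w_def exp_of_nat_mult[symmetric] by (simp only:)
  also have "\<dots> = 1"
    using exp_integer_2pi[of "of_int (int r - int s)"] by (simp add: mult_ac)
  finally have "w ^ N = 1" .
  have "cnj (exp (- \<i> * of_real ((t + 2 * pi * real k / real N) * real r))) *
      exp (- \<i> * of_real ((t + 2 * pi * real k / real N) * real s)) =
      exp (\<i> * of_real (t * (real r - real s))) * w ^ k" for k
    unfolding w_def exp_of_nat_mult[symmetric] exp_cnj mult_exp_exp
    by (simp add: algebra_simps diff_divide_distrib)
  then have "(\<Sum>k<N. cnj (exp (- \<i> * of_real ((t + 2 * pi * real k / real N) * real r))) *
      exp (- \<i> * of_real ((t + 2 * pi * real k / real N) * real s))) =
      exp (\<i> * of_real (t * (real r - real s))) * (\<Sum>k<N. w ^ k)"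
    by (simp only: sum_distrib_left)
  also have "(\<Sum>k<N. w ^ k) = 0"
    using \<open>w \<noteq> 1\<close> \<open>w ^ N = 1\<close> by (simp add: geometric_sum)
  finally show ?thesis
    using False by simp
qed

text \<open>The matrix of exponentials, indexed by \<open>k\<close> and \<open>r\<close>, is sqrt N
  times a unitary matrix, so orthogonality of the filters amounts to that of their polyphase
  vectors.\<close>

lemma sum_polyphase_inner:
  "(\<Sum>k<N. cnj (\<Sum>r<N. exp (- \<i> * of_real ((t + 2 * pi * real k / real N) * real r)) * p r) *
      (\<Sum>r<N. exp (- \<i> * of_real ((t + 2 * pi * real k / real N) * real r)) * q r)) = of_nat N * cip N p q"
proof -
  let ?e = "\<lambda>k r :: nat. exp (- \<i> * complex_of_real ((t + 2 * pi * real k / real N) * real r))"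
  have "(\<Sum>k<N. cnj (\<Sum>r<N. ?e k r * p r) * (\<Sum>s<N. ?e k s * q s)) =
      (\<Sum>k<N. \<Sum>r<N. \<Sum>s<N. (cnj (p r) * q s) * (cnj (?e k r) * ?e k s))"
    unfolding cnj_sum sum_product complex_cnj_mult by (intro sum.cong refl) (simp only: mult_ac)
  also have "\<dots> = (\<Sum>r<N. \<Sum>k<N. \<Sum>s<N. (cnj (p r) * q s) * (cnj (?e k r) * ?e k s))"
    by (rule sum.swap)
  also have "\<dots> = (\<Sum>r<N. \<Sum>s<N. (cnj (p r) * q s) * (\<Sum>k<N. cnj (?e k r) * ?e k s))"
    unfolding sum_distrib_left by (rule sum.cong[OF refl], rule sum.swap)
  also have "\<dots> = (\<Sum>r<N. \<Sum>s<N. if r = s then of_nat N * (cnj (p r) * q s) else 0)"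
    by (intro sum.cong refl, subst sum_exp_roots_of_unity) auto
  also have "\<dots> = of_nat N * cip N p q"
    by (simp add: cip_def sum_distrib_left)
  finally show ?thesis .
qed

theorem theorem2p1:
  fixes N g :: nat and \<phi> :: "real \<Rightarrow> complex"
  assumes "N \<ge> 2" and "g \<ge> 1"
    and "scaling_function N \<phi>"
    and "supported_in \<phi> {0..real N * real g - 1}"
  shows "\<exists>\<psi> :: nat \<Rightarrow> real \<Rightarrow> complex.
    wavelet_functions N \<phi> \<psi> \<and>
    (\<forall>i\<in>{1..N - 1}. supported_in (\<psi> i) {0..real N * real g - 1})"
proof -
  define M where "M = N * g - 1"
  define d where "d = (N - 1) * g - 1"
  define D where "D = (N - 1) * M"
  have "N > 0" "N * g > 0" "(N - 1) * g > 0"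
    using assms by auto
  then have M: "real N * real g - 1 = real M"
    by (simp add: M_def of_nat_diff)
  \<comment> \<open>Computed over the integers because the definitions use truncated subtraction. In
    the top block only the positions \<open>r = 0\<close> and \<open>r = 1\<close> have an index up
    to \<open>D\<close>.\<close>
  have D: "D = d * N + 1"
  proof -
    have "int D = (int N - 1) * (int N * int g - 1)"
      using assms \<open>N * g > 0\<close> by (simp add: D_def M_def of_nat_diff)
    also have "\<dots> = ((int N - 1) * int g - 1) * int N + 1"
      by (simp add: algebra_simps)
    also have "\<dots> = int (d * N + 1)"
      using assms \<open>(N - 1) * g > 0\<close> by (simp add: d_def of_nat_diff)
    finally show ?thesis
      by linarith
  qed
  have D_less: "D < Suc d * N"
    using assms by (simp add: D)
  have supp: "supported_in \<phi> {0..real M}"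
    using assms M by simp
  have \<phi>: "\<phi> \<in> L2"
    using assms by (simp add: scaling_function_def)
  obtain b where refine: "AE x in lborel. U_op N \<phi> x = (\<Sum>n\<le>D. b n * \<phi> (x - real n))"
    and b_0: "\<And>n. n > D \<Longrightarrow> b n = 0"
    and b_orth: "\<And>k. (\<Sum>n\<le>D. cnj (b n) * b (n + N * k)) = (if k = 0 then 1 else 0)"
    unfolding D_def by (rule scaling_function_refinement[OF assms(1,3) supp]) blast
  define v where "v = (\<lambda>l r. b (l * N + r))"
  \<comment> \<open>A shift by \<open>k\<close> blocks is a shift of the index by
    \<open>N * k\<close>, so this is \<open>b_orth\<close> again.\<close>
  have "(\<Sum>l\<le>d. cip N (v l) (v (l + k))) = (\<Sum>n<Suc d * N. cnj (b n) * b (n + N * k))" for k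
    unfolding sum_polyphase cip_def v_def by (intro sum.cong refl) (simp add: algebra_simps)
  also have "(\<Sum>n<Suc d * N. cnj (b n) * b (n + N * k)) = (\<Sum>n\<le>D. cnj (b n) * b (n + N * k))" for k
    using D_less b_0 by (intro sum.mono_neutral_right) auto
  finally have v_orth: "(\<Sum>l\<le>d. cip N (v l) (v (l + k))) = (if k = 0 then 1 else 0)" for k
    using b_orth by simp
  have v_0: "v l r = 0" if "l > d" for l r
  proof -
    have "Suc d * N \<le> l * N"
      using that by (intro mult_right_mono) auto
    then show ?thesis
      unfolding v_def using D_less by (intro b_0) linarith
  qed
  have "\<And>k. (\<Sum>l\<le>d. cip N (v l) (v (l + k))) = (if k = 0 then 1 else 0)"
    "\<And>l r. l > d \<Longrightarrow> r < N \<Longrightarrow> v l r = 0"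
    using v_orth v_0 by blast+
  from paraunitary_completion[OF \<open>N > 0\<close> this] obtain A where
    A: "(\<forall>l\<le>d. \<forall>r<N. A 0 l r = v l r) \<and>
    (\<forall>z. cmod z = 1 \<longrightarrow> (\<forall>i<N. \<forall>j<N.
       cip N (\<lambda>r. \<Sum>l\<le>d. A i l r * z ^ l) (\<lambda>r. \<Sum>l\<le>d. A j l r * z ^ l) = (if i = j then 1 else 0))) \<and>
    (d > 0 \<longrightarrow> (\<forall>i. \<exists>c. \<forall>r. A i d r = c * v d r))" ..
  have A_0: "A 0 l r = v l r" if "l \<le> d" "r < N" for l r
    using A that by blast
  have A_unitary: "cip N (\<lambda>r. \<Sum>l\<le>d. A i l r * z ^ l) (\<lambda>r. \<Sum>l\<le>d. A j l r * z ^ l) = (if i = j then 1 else 0)"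
    if "cmod z = 1" "i < N" "j < N" for z i j
    using A[THEN conjunct2, THEN conjunct1] that by blast
  have A_top: "\<exists>c. \<forall>r. A i d r = c * v d r" if "d > 0" for i
    using A[THEN conjunct2, THEN conjunct2] that by blast
  define c where "c = (\<lambda>i n. A i (n div N) (n mod N))"
  have c_A: "c i (l * N + r) = A i l r" if "r < N" for i l r
    using that by (simp add: c_def)
  have c_0: "c 0 n = b n" if "n \<le> D" for n
  proof -
    have "n < Suc d * N"
      using that D_less by linarith
    then have "n div N < Suc d"
      by (simp add: less_mult_imp_div_less)
    then show ?thesis
      using assms(1) by (simp add: c_def A_0 v_def)
  qed
  \<comment> \<open>Here \<open>r > 1\<close>, so \<open>v d r = 0\<close>, and the top coefficient
    of each column inherits this zero. For \<open>d = 0\<close> no such \<open>r\<close> exists, as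
    then \<open>N = 2\<close>.\<close>
  have c_large: "c i n = 0" if n: "D < n" "n < Suc d * N" for i n
  proof -
    define r where "r = n - d * N"
    have r: "n = d * N + r" "r < N" "r > 1"
      using n by (auto simp: r_def D)
    have "d > 0"
    proof (rule ccontr)
      assume "\<not> d > 0"
      then have "(N - 1) * g = 1"
        using \<open>(N - 1) * g > 0\<close> unfolding d_def by linarith
      then have "N - 1 = 1"
        by (simp only: nat_mult_eq_1_iff)
      then have "N = 2"
        by linarith
      then show False
        using r by simp
    qed
    then obtain a where "A i d r = a * v d r"
      using A_top by blast
    moreover have "v d r = 0"
      unfolding v_def using n r by (intro b_0) simp
    ultimately show ?thesis
      using r by (simp add: c_A)
  qed
  \<comment> \<open>U^(-1) applied to the combination of the translates of \<open>\<phi>\<close>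
    with coefficients \<open>c i n\<close>.\<close>
  define \<psi> where "\<psi> = (\<lambda>i x. \<Sum>n\<le>D. (of_real (sqrt (real N)) * c i n) * \<phi> (- real n + real N * x))"
  have \<psi>_L2: "\<psi> i \<in> L2" for i
    unfolding \<psi>_def using \<phi> assms(1) by (intro L2_lin_comb L2_affine) auto
  have "AE x in lborel. \<forall>n\<in>{..D}. - real n + real N * x \<notin> {0..real M} \<longrightarrow> \<phi> (- real n + real N * x) = 0"
  proof (rule eventually_ball_finite[rule_format])
    fix n
    have [measurable]: "\<phi> \<in> borel_measurable borel"
      using \<phi> by (rule L2_measurable)
    show "AE x in lborel. - real n + real N * x \<notin> {0..real M} \<longrightarrow> \<phi> (- real n + real N * x) = 0"
      using supp assms(1) unfolding supported_in_def by (rule_tac AE_lborel_affine) auto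
  qed simp
  then have \<psi>_supp: "supported_in (\<psi> i) {0..real M}" for i
    unfolding supported_in_def
  proof eventually_elim
    case (elim x)
    show ?case
    proof
      assume x: "x \<notin> {0..real M}"
      have "- real n + real N * x \<notin> {0..real M}" if "n \<le> D" for n
      proof (cases "x < 0")
        case True
        then have "real N * x < 0"
          using assms(1) by (simp add: mult_less_0_iff)
        then show ?thesis
          by simp
      next
        case False
        then have "real N * real M < real N * x"
          using x assms(1) by simp
        \<comment> \<open>The degree bound is exactly what is needed: for \<open>x > M\<close> it
          gives N x - n > N M - D = M.\<close>
        moreover have "real n \<le> real N * real M - real M"
        proof -
          have "real n \<le> real D"
            using that by simp
          also have "real D = real N * real M - real M"
            using assms(1) by (simp add: D_def of_nat_diff algebra_simps)
          finally show ?thesis .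
        qed
        ultimately show ?thesis
          by simp
      qed
      then show "\<psi> i x = 0"
        unfolding \<psi>_def using elim by (intro sum.neutral) auto
    qed
  qed
  have U_\<psi>: "U_op N (\<psi> i) x = (\<Sum>n\<le>D. c i n * \<phi> (x - real n))" for i x
  proof -
    have "real N powr (- 1 / 2) * sqrt (real N) = 1"
      unfolding powr_half_sqrt[symmetric, OF of_nat_0_le_iff] powr_add[symmetric] using assms(1) by simp
    then have "complex_of_real (real N powr (- 1 / 2)) * (of_real (sqrt (real N)) * z) = z" for z
      unfolding mult.assoc[symmetric] of_real_mult[symmetric] by simp
    moreover have "- real n + real N * (x / real N) = x - real n" for n
      using assms(1) by simp
    ultimately show ?thesis
      unfolding U_op_def \<psi>_def sum_distrib_left mult.assoc by (simp only:)
  qed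
  have m_0: "trig_poly D (c 0) = trig_poly D b"
    by (auto simp: trig_poly_def c_0 fun_eq_iff intro!: sum.cong)
  have qmf: "(\<Sum>k<N. cnj (trig_poly D (c i) (t + 2 * pi * real k / real N)) *
      trig_poly D (c j) (t + 2 * pi * real k / real N)) = (if i = j then of_nat N else 0)"
    if "i < N" "j < N" for i j t
  proof -
    \<comment> \<open>The point \<open>?z\<close> is the same for all shifts of \<open>t\<close> by
      2 pi k / N, so a single unitary matrix serves all \<open>k\<close>.\<close>
    let ?z = "exp (- \<i> * of_real (t * real N))"
    have z: "exp (- \<i> * of_real ((t + 2 * pi * real k / real N) * real N)) = ?z" for k
      using assms(1) by (intro exp_eq[THEN iffD2] exI[of _ "- int k"]) (simp add: algebra_simps)
    have poly: "trig_poly D (c i) (t + 2 * pi * real k / real N) =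
        (\<Sum>r<N. exp (- \<i> * of_real ((t + 2 * pi * real k / real N) * real r)) * (\<Sum>l\<le>d. A i l r * ?z ^ l))" for i k
    proof -
      have "trig_poly D (c i) s = (\<Sum>r<N. exp (- \<i> * of_real (s * real r)) *
          (\<Sum>l\<le>d. A i l r * exp (- \<i> * of_real (s * real N)) ^ l))" for s
        by (subst trig_poly_polyphase[OF D_less c_large], assumption, assumption) (simp add: c_A)
      then show ?thesis
        by (simp only: z)
    qed
    have "cmod ?z = 1"
      by simp
    then show ?thesis
      unfolding poly sum_polyphase_inner using A_unitary[of ?z i j] that by simp
  qed
  have "wavelet_functions N \<phi> \<psi>"
    unfolding wavelet_functions_def low_pass_filter_def
  proof (intro exI[of _ "\<lambda>i. trig_poly D (c i)"] conjI ballI periodic_L2_trig_poly AE_I2 allI impI qmf \<psi>_L2)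
    show "filter_relation N \<phi> (trig_poly D (c 0)) \<phi>"
      unfolding m_0 using assms(1) \<phi> supp refine by (intro filter_relation_trig_poly) auto
    show "filter_relation N \<phi> (trig_poly D (c i)) (\<psi> i)" for i
      using assms(1) \<phi> supp \<psi>_L2 \<psi>_supp U_\<psi> by (intro filter_relation_trig_poly) auto
  qed
  then show ?thesis
    using \<psi>_supp M by auto
qed

end
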